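(* Let $T>0$ and let $F\colon\mathbb{R}\times\mathbb{R}^2\to\mathbb{R}^2$ satisfy the following six assumptions. (1) $F$ satisfies the Carathéodory conditions and is $T$-periodic in $t$. (2) For every $(\bar t,\bar z)\in\mathbb{R}\times\mathbb{R}^2$ the solution of the Cauchy problem $\dot z=F(t,z)$, $z(\bar t)=\bar z$ is unique. (3) For every $\bar t\in[0,T]$ the solution of the Cauchy problem $\dot z=F(t,z)$, $z(\bar t)=0_{\mathbb{R}^2}$ can be continued to the whole interval $[0,T]$. (4) For every $z_0\in\mathbb{R}^2$ such that the solution of $\dot z=F(t,z)$, $z(0)=z_0$ blows up at a finite time $T_{\mathrm F}\in(0,T]$, one has $\lim_{t\to T_{\mathrm F}^-}\mathrm{rot}_t(z_0)=+\infty$. (5) $\lim_{|z_0|\to+\infty}\overline{\mathrm{rot}}_T(z_0)=+\infty$. (6) $\displaystyle\liminf_{|z|\to+\infty}\frac{\langle F(t,z),Jz\rangle}{|z|^2}=\ell>-\infty$ uniformly for a.e. $t\in[0,T]$. Then the planar system $\dot z=F(t,z)$ admits at least one $T$-periodic solution.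
   Context: $|\cdot|$ and $\langle\cdot,\cdot\rangle$ are the Euclidean norm and scalar product on $\mathbb{R}^2$; $J=\begin{pmatrix}0&1\\-1&0\end{pmatrix}$. Carathéodory conditions for $F$: for every $z$ the map $t\mapsto F(t,z)$ is measurable; for a.e. $t$ the map $z\mapsto F(t,z)$ is continuous; for every compact $[a,b]\times K\subset\mathbb{R}\times\mathbb{R}^2$ there is $m_K\in L^1([a,b])$ with $|F(t,z)|\le m_K(t)$ for a.e. $t\in[a,b]$ and every $z\in K$. Solutions are understood in the Carathéodory sense (absolutely continuous functions satisfying the equation a.e.). $\zeta(t;\bar t,\bar z)$ denotes the solution of $\dot z=F(t,z)$, $z(\bar t)=\bar z$, for all $t$ for which it is defined (maximal solution). Set $\phi(t,z_0)=\zeta(t;0,z_0)$. The solution with $z(0)=z_0$ blows up at a finite time $T_{\mathrm F}$ if its maximal interval of existence to the right of $0$ is $[0,T_{\mathrm F})$. $\mathcal N$ is the set of $z_0\in\mathbb{R}^2$ for which there is $t\in[0,T]$ such that $\phi(t,z_0)$ is defined and equals $0_{\mathbb{R}^2}$. Clockwise rotation: if the solution $\phi(\cdot,z_0)$ exists on $[0,t]$ and does not vanish there, $$\mathrm{rot}_t(z_0)=\frac1{2\pi}\int_0^t\frac{\langle F(s,\phi(s,z_0)),J\phi(s,z_0)\rangle}{|\phi(s,z_0)|^2}\,ds .$$ (Under assumption (3), a solution with $z(0)=z_0$ blowing up at $T_{\mathrm F}\in(0,T]$ does not vanish on $[0,T_{\mathrm F})$, so $\mathrm{rot}_t(z_0)$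 is defined for $t<T_{\mathrm F}$.) Generalized rotation: for $t\in[0,T]$ and $z_0\in\mathbb{R}^2\setminus\mathcal N$, $\overline{\mathrm{rot}}_t(z_0)=\mathrm{rot}_t(z_0)$ if this is well defined (i.e. the solution exists on $[0,t]$), and $\overline{\mathrm{rot}}_t(z_0)=+\infty$ otherwise. The limit in (5) is taken over $z_0\in\mathbb{R}^2\setminus\mathcal N$ ($\mathcal N$ is bounded under (1)–(3)). In (6), the uniform liminf $\ell\in[-\infty,+\infty]$ is the supremum of all $\lambda\in\mathbb{R}$ for which there is $R>0$ such that $\langle F(t,z),Jz\rangle\ge\lambda|z|^2$ for a.e. $t\in[0,T]$ and every $|z|\ge R$; the assumption is $\ell>-\infty$. *)

theory Defs
  imports "HOL-Analysis.Analysis"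
begin

definition J :: "real^2^2" where
  "J = vector [vector [0, 1], vector [-1, 0]]"

lemma J_mult: "J *v z = vector [z $ 2, - z $ 1]"
  by (simp add: J_def vec_eq_iff forall_2 matrix_vector_mult_def sum_2)

subsection \<open>Caratheodory solutions\<close>

text \<open>The usual epsilon-delta notion, over finite families of non-overlapping compact intervals
  contained in \<open>A\<close>; the library's \<open>absolutely_continuous\<close> is about measures.\<close>

definition absolutely_continuous_on :: "real set \<Rightarrow> (real \<Rightarrow> 'a::metric_space) \<Rightarrow> bool" where
  "absolutely_continuous_on A f \<longleftrightarrow>
    (\<forall>\<epsilon>>0. \<exists>\<delta>>0. \<forall>D S. D division_of S \<and> S \<subseteq> A \<and> (\<Sum>K\<in>D. measure lborel K) < \<delta>
      \<longrightarrow> (\<Sum>K\<in>D. dist (f (Inf K)) (f (Sup K))) < \<epsilon>)"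

text \<open>Measurability and ``almost every'' refer to Lebesgue (not Borel) measure.\<close>

definition caratheodory :: "(real \<Rightarrow> real^2 \<Rightarrow> real^2) \<Rightarrow> bool" where
  "caratheodory F \<longleftrightarrow>
    (\<forall>z. (\<lambda>t. F t z) \<in> borel_measurable lebesgue) \<and>
    (AE t in lebesgue. continuous_on UNIV (F t)) \<and>
    (\<forall>a b K. compact K \<longrightarrow>
      (\<exists>m::real \<Rightarrow> real. set_integrable lebesgue {a..b} m \<and>
        (AE t in lebesgue_on {a..b}. \<forall>z\<in>K. norm (F t z) \<le> m t)))"

text \<open>On an interval that is not compact, a solution is required to be absolutely continuous on
  every compact subinterval.\<close>

definition solution_on :: "(real \<Rightarrow> real^2 \<Rightarrow> real^2) \<Rightarrow> real set \<Rightarrow> (real \<Rightarrow> real^2) \<Rightarrow> bool" where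
  "solution_on F I x \<longleftrightarrow>
    is_interval I \<and>
    (\<forall>a b. {a..b} \<subseteq> I \<longrightarrow> absolutely_continuous_on {a..b} x) \<and>
    (AE t in lebesgue_on I. (x has_vector_derivative F t (x t)) (at t within I))"

definition cauchy_solution ::
    "(real \<Rightarrow> real^2 \<Rightarrow> real^2) \<Rightarrow> real \<Rightarrow> real^2 \<Rightarrow> real set \<Rightarrow> (real \<Rightarrow> real^2) \<Rightarrow> bool" where
  "cauchy_solution F t0 z0 I x \<longleftrightarrow> t0 \<in> I \<and> solution_on F I x \<and> x t0 = z0"

definition unique_solutions :: "(real \<Rightarrow> real^2 \<Rightarrow> real^2) \<Rightarrow> bool" where
  "unique_solutions F \<longleftrightarrow>
    (\<forall>t0 z0 I1 I2 x1 x2. cauchy_solution F t0 z0 I1 x1 \<and> cauchy_solution F t0 z0 I2 x2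
      \<longrightarrow> (\<forall>t\<in>I1 \<inter> I2. x1 t = x2 t))"

subsection \<open>The maximal solution\<close>

text \<open>\<open>existence_interval F t0 z0\<close> is the domain of the maximal solution and \<open>\<zeta> F t0 z0 t\<close> its value
  at \<open>t\<close>; the latter is meaningful under \<open>unique_solutions F\<close> and for \<open>t\<close> in that domain.\<close>

definition existence_interval :: "(real \<Rightarrow> real^2 \<Rightarrow> real^2) \<Rightarrow> real \<Rightarrow> real^2 \<Rightarrow> real set" where
  "existence_interval F t0 z0 = \<Union>{I. \<exists>x. cauchy_solution F t0 z0 I x}"

definition \<zeta> :: "(real \<Rightarrow> real^2 \<Rightarrow> real^2) \<Rightarrow> real \<Rightarrow> real^2 \<Rightarrow> real \<Rightarrow> real^2" where
  "\<zeta> F t0 z0 t = (THE z. \<exists>I x. cauchy_solution F t0 z0 I x \<and> t \<in> I \<and> x t = z)"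

lemma zeta_eq:
  assumes "unique_solutions F" "cauchy_solution F t0 z0 I x" "t \<in> I"
  shows "\<zeta> F t0 z0 t = x t"
  unfolding \<zeta>_def
proof (rule the_equality)
  show "\<exists>I y. cauchy_solution F t0 z0 I y \<and> t \<in> I \<and> y t = x t"
    using assms(2,3) by blast
next
  fix z assume "\<exists>I y. cauchy_solution F t0 z0 I y \<and> t \<in> I \<and> y t = z"
  then obtain I' y where "cauchy_solution F t0 z0 I' y" "t \<in> I'" "y t = z" by blast
  then show "z = x t"
    using assms unfolding unique_solutions_def by blast
qed

definition \<phi> :: "(real \<Rightarrow> real^2 \<Rightarrow> real^2) \<Rightarrow> real \<Rightarrow> real^2 \<Rightarrow> real^2" where
  "\<phi> F t z0 = \<zeta> F 0 z0 t"

definition blows_up_at :: "(real \<Rightarrow> real^2 \<Rightarrow> real^2) \<Rightarrow> real^2 \<Rightarrow> real \<Rightarrow> bool" where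
  "blows_up_at F z0 TF \<longleftrightarrow> 0 < TF \<and> existence_interval F 0 z0 \<inter> {0..} = {0..<TF}"

subsection \<open>Rotation\<close>

definition vanishing_set :: "(real \<Rightarrow> real^2 \<Rightarrow> real^2) \<Rightarrow> real \<Rightarrow> (real^2) set" where
  "vanishing_set F T = {z0. \<exists>t\<in>{0..T}. t \<in> existence_interval F 0 z0 \<and> \<phi> F t z0 = 0}"

definition rot :: "(real \<Rightarrow> real^2 \<Rightarrow> real^2) \<Rightarrow> real \<Rightarrow> real^2 \<Rightarrow> real" where
  "rot F t z0 = 1 / (2 * pi) *
    set_lebesgue_integral lebesgue {0..t}
      (\<lambda>s. (F s (\<phi> F s z0) \<bullet> (J *v \<phi> F s z0)) / (norm (\<phi> F s z0))\<^sup>2)"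

text \<open>Only used for \<open>z0\<close> outside \<open>vanishing_set F T\<close> and \<open>0 \<le> t \<le> T\<close>, where existence on \<open>{0..t}\<close>
  suffices for \<open>rot F t z0\<close> to be well defined.\<close>

definition generalized_rot :: "(real \<Rightarrow> real^2 \<Rightarrow> real^2) \<Rightarrow> real \<Rightarrow> real^2 \<Rightarrow> ereal" where
  "generalized_rot F t z0 =
    (if {0..t} \<subseteq> existence_interval F 0 z0 then ereal (rot F t z0) else \<infinity>)"

definition angular_liminf :: "(real \<Rightarrow> real^2 \<Rightarrow> real^2) \<Rightarrow> real \<Rightarrow> ereal" where
  "angular_liminf F T = Sup {ereal l | l::real. \<exists>R>0. AE t in lebesgue_on {0..T}.
      \<forall>z. norm z \<ge> R \<longrightarrow> F t z \<bullet> (J *v z) \<ge> l * (norm z)\<^sup>2}"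

end

theory Submission
  imports Defs "HOL-Complex_Analysis.Great_Picard"
begin

text \<open>
  Let \<open>P = \<phi> F T\<close> be the Poincare map, defined on the open set \<open>U\<close> of initial values whose solution
  reaches \<open>T\<close>. By the third assumption \<open>U\<close> contains the set \<open>N\<close> of initial values whose solution meets
  the origin, and \<open>N\<close> is compact. On \<open>U - N\<close> the rotation \<open>rot F T\<close> is continuous, and it tends to
  infinity both at infinity and at the boundary points of \<open>U\<close>: a solution starting close to one that
  blows up makes many turns before the blow-up time and also becomes large; hence it stays away from the
  origin on all of \<open>[0, T]\<close>, and the liminf condition together with the Caratheodory bound prevents it
  from unwinding by more than a fixed amount afterwards.

  Let \<open>W\<close> be a neighbourhood of \<open>N\<close> with compact closure in \<open>U\<close>, and \<open>n\<close> a natural number bounding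
  \<open>rot F T\<close> on the frontier of \<open>W\<close>. The set of points that lie in \<open>W\<close> or satisfy
  \<open>rot F T < n + 1/2\<close> is open, bounded, contains the origin, and its closure lies in \<open>U\<close>.
  On its frontier \<open>rot F T = n + 1/2\<close>, so \<open>P z\<close> is a negative multiple of \<open>z\<close>, and the Leray-Schauder
  principle gives a fixed point of \<open>P\<close>.
\<close>

subsection \<open>Absolute continuity\<close>

text \<open>On \<open>N\<close> the angle of a solution is undefined, and \<open>rot F T\<close> may
  be unbounded nearby, so a sublevel set of it could have points of \<open>N\<close> on its
  frontier, where nothing is known about \<open>P\<close>. Adding \<open>W\<close> moves all of
  \<open>N\<close> into the interior. At a half-integer level a solution has turned by an odd
  multiple of pi, which excludes \<open>P z = \<mu> z\<close> with \<open>\<mu> > 1\<close>, the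
  only obstruction to the homotopy from \<open>0\<close> to \<open>P\<close>.

  That a large solution avoids the origin is a matter of compactness: solutions through the origin
  are global and depend continuously on their data, so those that enter a small ball of radius
  \<open>r\<close> at any time in \<open>[0, T]\<close> share one bound \<open>C\<close> on
  \<open>[0, T]\<close>. A solution that exceeds \<open>C\<close> therefore never enters the ball,
  and its angular velocity has an integrable lower bound.

  Uniqueness is assumed without a Lipschitz condition, so continuity of the flow rests on
  compactness too: truncation gives an integrably bounded system, its solutions are equicontinuous,
  and uniqueness identifies every limit.\<close>

lemma division_of_endpoints:
  fixes S :: "real set"
  assumes "D division_of S" "K \<in> D"
  shows "Inf K \<in> S" "Sup K \<in> S"
proof -
  obtain u v where "K = cbox u v" using division_ofD(4)[OF assms] by blast
  moreover have "K \<noteq> {}" "K \<subseteq> S" using division_ofD(2,3)[OF assms] by auto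
  ultimately show "Inf K \<in> S" "Sup K \<in> S" by (auto simp: subset_iff)
qed

lemma absolutely_continuous_onD:
  assumes "absolutely_continuous_on A f" "\<epsilon> > 0"
  obtains \<delta> where "\<delta> > 0" "\<And>D. D division_of \<Union>D \<Longrightarrow> \<Union>D \<subseteq> A \<Longrightarrow> (\<Sum>K\<in>D. measure lborel K) < \<delta>
      \<Longrightarrow> (\<Sum>K\<in>D. dist (f (Inf K)) (f (Sup K))) < \<epsilon>"
  using assms unfolding absolutely_continuous_on_def by metis

lemma absolutely_continuous_on_subset:
  "absolutely_continuous_on A f \<Longrightarrow> B \<subseteq> A \<Longrightarrow> absolutely_continuous_on B f"
  unfolding absolutely_continuous_on_def by (meson subset_trans)

lemma absolutely_continuous_on_cong:
  assumes "absolutely_continuous_on A f" "\<And>t. t \<in> A \<Longrightarrow> f t = g t"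
  shows "absolutely_continuous_on A g"
  unfolding absolutely_continuous_on_def
proof (intro allI impI)
  fix e :: real assume "e > 0"
  then obtain d where d: "d > 0" "\<And>D. D division_of \<Union>D \<Longrightarrow> \<Union>D \<subseteq> A \<Longrightarrow> (\<Sum>K\<in>D. measure lborel K) < d
      \<Longrightarrow> (\<Sum>K\<in>D. dist (f (Inf K)) (f (Sup K))) < e"
    using absolutely_continuous_onD[OF assms(1)] by metis
  have "(\<Sum>K\<in>D. dist (g (Inf K)) (g (Sup K))) < e"
    if D: "D division_of S \<and> S \<subseteq> A \<and> (\<Sum>K\<in>D. measure lborel K) < d" for D S
  proof -
    have "\<Union>D = S" using D by (auto simp: division_of_def)
    have "(\<Sum>K\<in>D. dist (g (Inf K)) (g (Sup K))) = (\<Sum>K\<in>D. dist (f (Inf K)) (f (Sup K)))"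
    proof (rule sum.cong[OF refl])
      fix K assume "K \<in> D"
      then have "Inf K \<in> A" "Sup K \<in> A" using division_of_endpoints[of D S K] D by auto
      then show "dist (g (Inf K)) (g (Sup K)) = dist (f (Inf K)) (f (Sup K))"
        by (simp add: assms(2))
    qed
    then show ?thesis using d(2)[of D] D \<open>\<Union>D = S\<close> by simp
  qed
  then show "\<exists>\<delta>>0. \<forall>D S. D division_of S \<and> S \<subseteq> A \<and> (\<Sum>K\<in>D. measure lborel K) < \<delta> \<longrightarrow> (\<Sum>K\<in>D. dist (g (Inf K)) (g (Sup K))) < e"
    using d(1) by blast
qed

text \<open>Serves for products of absolutely continuous functions; the ranges of \<open>f\<close>
  and \<open>g\<close> may differ in type, as for a planar solution and a complex integrating
  factor.\<close>

lemma absolutely_continuous_on_lipschitz2: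
  assumes f: "absolutely_continuous_on {a..b} f" and g: "absolutely_continuous_on {a..b} g"
    and C: "C > 0"
    and le: "\<And>u v. u \<in> {a..b} \<Longrightarrow> v \<in> {a..b} \<Longrightarrow> dist (h u) (h v) \<le> C * dist (f u) (f v) + C * dist (g u) (g v)"
  shows "absolutely_continuous_on {a..b} h"
  unfolding absolutely_continuous_on_def
proof (intro allI impI)
  fix e :: real assume "e > 0"
  then have e2: "e / (2*C) > 0" using C by simp
  obtain d1 where d1: "d1 > 0" "\<And>D. D division_of \<Union>D \<Longrightarrow> \<Union>D \<subseteq> {a..b} \<Longrightarrow> (\<Sum>K\<in>D. measure lborel K) < d1
      \<Longrightarrow> (\<Sum>K\<in>D. dist (f (Inf K)) (f (Sup K))) < e / (2*C)"
    using absolutely_continuous_onD[OF f e2] by metis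
  obtain d2 where d2: "d2 > 0" "\<And>D. D division_of \<Union>D \<Longrightarrow> \<Union>D \<subseteq> {a..b} \<Longrightarrow> (\<Sum>K\<in>D. measure lborel K) < d2
      \<Longrightarrow> (\<Sum>K\<in>D. dist (g (Inf K)) (g (Sup K))) < e / (2*C)"
    using absolutely_continuous_onD[OF g e2] by metis
  have "(\<Sum>K\<in>D. dist (h (Inf K)) (h (Sup K))) < e"
    if D: "D division_of S \<and> S \<subseteq> {a..b} \<and> (\<Sum>K\<in>D. measure lborel K) < min d1 d2" for D S
  proof -
    have US: "\<Union>D = S" using D by (auto simp: division_of_def)
    have "(\<Sum>K\<in>D. dist (h (Inf K)) (h (Sup K)))
      \<le> (\<Sum>K\<in>D. C * dist (f (Inf K)) (f (Sup K)) + C * dist (g (Inf K)) (g (Sup K)))"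
    proof (rule sum_mono)
      fix K assume "K \<in> D"
      then have "Inf K \<in> {a..b}" "Sup K \<in> {a..b}" using division_of_endpoints[of D S K] D by auto
      then show "dist (h (Inf K)) (h (Sup K)) \<le> C * dist (f (Inf K)) (f (Sup K)) + C * dist (g (Inf K)) (g (Sup K))"
        by (rule le)
    qed
    also have "\<dots> = C * (\<Sum>K\<in>D. dist (f (Inf K)) (f (Sup K))) + C * (\<Sum>K\<in>D. dist (g (Inf K)) (g (Sup K)))"
      by (simp add: sum.distrib sum_distrib_left)
    also have "\<dots> < C * (e / (2*C)) + C * (e / (2*C))"
      using d1(2)[of D] d2(2)[of D] D US C by (intro add_strict_mono mult_strict_left_mono) auto
    also have "\<dots> = e" using C by (simp add: field_simps)
    finally show ?thesis .
  qed
  then show "\<exists>\<delta>>0. \<forall>D S. D division_of S \<and> S \<subseteq> {a..b} \<and> (\<Sum>K\<in>D. measure lborel K) < \<delta> \<longrightarrow> (\<Sum>K\<in>D. dist (h (Inf K)) (h (Sup K))) < e"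
    using d1(1) d2(1) by (intro exI[of _ "min d1 d2"]) auto
qed

text \<open>Split \<open>norm f\<close> at a height \<open>n\<close>: the part above it has integral
  less than \<open>e/2\<close> over the whole interval, and the part below contributes at most
  \<open>n\<close> times the total length of the family.\<close>

lemma absolutely_continuous_on_integral:
  fixes f :: "real \<Rightarrow> 'a::euclidean_space"
  assumes f: "f absolutely_integrable_on {a..b}"
  shows "absolutely_continuous_on {a..b} (\<lambda>t. c + integral {a..t} f)"
  unfolding absolutely_continuous_on_def
proof (intro allI impI)
  fix e :: real assume "e > 0"
  define h where "h = (\<lambda>t. norm (f t))"
  have h: "h absolutely_integrable_on {a..b}"
    unfolding h_def using f by (rule absolutely_integrable_norm[unfolded o_def])
  define g where "g = (\<lambda>(n::nat) t. min (h t) (real n))"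
  have g: "g n absolutely_integrable_on {a..b}" for n
    unfolding g_def by (intro absolutely_integrable_min_1 h absolutely_integrable_on_const) auto
  have gi: "g n integrable_on {a..b}" and hi: "h integrable_on {a..b}" for n
    using g h set_lebesgue_integral_eq_integral(1) by blast+
  have "(\<lambda>n. integral {a..b} (g n)) \<longlonglongrightarrow> integral {a..b} h"
  proof (rule dominated_convergence(2)[where h=h])
    show "norm (g n t) \<le> h t" for n t by (auto simp: g_def h_def)
    show "(\<lambda>n. g n t) \<longlonglongrightarrow> h t" for t
    proof -
      obtain N :: nat where "h t \<le> real N" using real_arch_simple by blast
      then have "\<forall>\<^sub>F n in sequentially. g n t = h t"
        by (auto simp: eventually_sequentially g_def intro!: exI[of _ N] order_trans[of _ "real N"])
      then show ?thesis by (rule tendsto_eventually)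
    qed
  qed (use gi hi in auto)
  then have "\<forall>\<^sub>F n in sequentially. integral {a..b} h - e/2 < integral {a..b} (g n)"
    using order_tendstoD(1) \<open>e > 0\<close> by (metis diff_less_eq less_add_same_cancel1 half_gt_zero)
  then obtain n where n: "integral {a..b} h - e/2 < integral {a..b} (g n)"
    by (auto simp: eventually_sequentially)
  \<comment> \<open>\<open>n\<close> may be \<open>0\<close>; the shift by one keeps the divisor in
    \<open>\<delta>\<close> positive.\<close>
  define r where "r = real n + 1"
  have r: "r > 0" "real n \<le> r" by (auto simp: r_def)
  define \<delta> where "\<delta> = e / (2 * r)"
  have "\<delta> > 0" using \<open>e > 0\<close> r by (simp add: \<delta>_def)
  have "(\<Sum>K\<in>D. dist (c + integral {a..Inf K} f) (c + integral {a..Sup K} f)) < e"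
    if D: "D division_of S \<and> S \<subseteq> {a..b} \<and> (\<Sum>K\<in>D. measure lborel K) < \<delta>" for D S
  proof -
    have D1: "D division_of S" and Sab: "S \<subseteq> {a..b}" and Sd: "(\<Sum>K\<in>D. measure lborel K) < \<delta>"
      using D by auto
    have US: "\<Union>D = S" using D by (auto simp: division_of_def)
    have fin: "finite D" using D1 by auto
    have SL: "S \<in> sets lebesgue"
      using D1 by (metis fin US division_ofD(4) lmeasurable_cbox fmeasurableD sets.finite_Union subsetI)
    have hS: "h absolutely_integrable_on S" "g n absolutely_integrable_on S"
      using set_integrable_subset[OF _ SL Sab] h g by auto
    have hSi: "h integrable_on S" "g n integrable_on S"
      using hS set_lebesgue_integral_eq_integral(1) by blast+
    have "(\<Sum>K\<in>D. dist (c + integral {a..Inf K} f) (c + integral {a..Sup K} f)) \<le> (\<Sum>K\<in>D. integral K h)"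
    proof (rule sum_mono)
      fix K assume "K \<in> D"
      then obtain u v where K: "K = {u..v}" "K \<noteq> {}" "K \<subseteq> {a..b}"
        using D by (metis box_real(2) division_ofD(2,3,4) order_trans)
      then have uv: "u \<le> v" "a \<le> u" "v \<le> b" by auto
      have fi: "f integrable_on {a..b}" using f set_lebesgue_integral_eq_integral(1) by blast
      have "integral {a..v} f = integral {a..u} f + integral {u..v} f"
        by (rule Henstock_Kurzweil_Integration.integral_combine[symmetric])
          (use uv in \<open>auto intro: integrable_on_subinterval[OF fi]\<close>)
      then have "dist (c + integral {a..Inf K} f) (c + integral {a..Sup K} f) = norm (integral {u..v} f)"
        using K uv by (simp add: dist_norm)
      also have "\<dots> \<le> integral {u..v} h"
        by (rule integral_norm_bound_integral)
          (use uv in \<open>auto simp: h_def intro: integrable_on_subinterval[OF fi]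
             integrable_on_subinterval[OF hi, unfolded h_def]\<close>)
      finally show "dist (c + integral {a..Inf K} f) (c + integral {a..Sup K} f) \<le> integral K h"
        using K by simp
    qed
    also have "\<dots> = integral S h"
      using integral_combine_division_topdown[OF hSi(1) D1] by simp
    also have "\<dots> = integral S (\<lambda>t. h t - g n t) + integral S (g n)"
      by (simp add: Henstock_Kurzweil_Integration.integral_diff hSi)
    also have "integral S (\<lambda>t. h t - g n t) \<le> integral {a..b} (\<lambda>t. h t - g n t)"
      by (rule integral_subset_le) (use Sab hSi gi hi in \<open>auto simp: g_def intro: integrable_diff\<close>)
    also have "integral {a..b} (\<lambda>t. h t - g n t) = integral {a..b} h - integral {a..b} (g n)"
      by (simp add: Henstock_Kurzweil_Integration.integral_diff gi hi)
    also have "integral S (g n) = (\<Sum>K\<in>D. integral K (g n))"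
      using integral_combine_division_topdown[OF hSi(2) D1] by simp
    also have "\<dots> \<le> (\<Sum>K\<in>D. real n * measure lborel K)"
    proof (rule sum_mono)
      fix K assume KD: "K \<in> D"
      then obtain u v where K: "K = cbox u v" "K \<noteq> {}" "K \<subseteq> {a..b}"
        using D by (metis division_ofD(2,3,4) order_trans)
      have "integral K (g n) \<le> integral K (\<lambda>_. real n)"
        by (rule integral_le) (use K in \<open>auto simp: g_def[abs_def] intro: integrable_on_subinterval[OF gi, unfolded g_def]\<close>)
      then show "integral K (g n) \<le> real n * measure lborel K"
        using K by (simp add: mult.commute)
    qed
    also have "\<dots> = real n * (\<Sum>K\<in>D. measure lborel K)" by (simp add: sum_distrib_left)
    also have "\<dots> \<le> r * \<delta>"
      using Sd r by (intro mult_mono) (auto simp: sum_nonneg)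
    also have "\<dots> = e / 2" using r by (simp add: \<delta>_def)
    finally show ?thesis using n by simp
  qed
  then show "\<exists>\<delta>>0. \<forall>D S. D division_of S \<and> S \<subseteq> {a..b} \<and> (\<Sum>K\<in>D. measure lborel K) < \<delta> \<longrightarrow>
     (\<Sum>K\<in>D. dist (c + integral {a..Inf K} f) (c + integral {a..Sup K} f)) < e"
    using \<open>\<delta> > 0\<close> by blast
qed

text \<open>The Henstock-Kurzweil integral is tested only on divisions finer than a chosen gauge, so
  the null set of bad tags can be isolated by the gauge and no covering theorem enters.\<close>

lemma absolutely_continuous_on_FTC:
  fixes f :: "real \<Rightarrow> 'a::banach"
  assumes ab: "a \<le> b" and ac: "absolutely_continuous_on {a..b} f" and N: "negligible N"
    and deriv: "\<And>t. t \<in> {a..b} - N \<Longrightarrow> (f has_vector_derivative g t) (at t within {a..b})"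
  shows "(g has_integral f b - f a) {a..b}"
proof -
  \<comment> \<open>With value \<open>0\<close> on \<open>N\<close>, a tag in \<open>N\<close>
    contributes only the increment of \<open>f\<close> to the error.\<close>
  define g' where "g' = (\<lambda>t. if t \<in> N then 0 else g t)"
  have "(g' has_integral f b - f a) {a..b}"
    unfolding has_integral_real
  proof (intro allI impI)
    fix e :: real assume e: "e > 0"
    \<comment> \<open>The \<open>+ 1\<close> covers \<open>a = b\<close> and makes the total error
      of the good tags strictly less than \<open>e/2\<close>.\<close>
    define e' where "e' = e / (2 * (b - a + 1))"
    have e': "e' > 0" using e ab by (simp add: e'_def)
    obtain \<delta> where \<delta>: "\<delta> > 0" "\<And>D. D division_of \<Union>D \<Longrightarrow> \<Union>D \<subseteq> {a..b} \<Longrightarrow> (\<Sum>K\<in>D. measure lborel K) < \<delta>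
      \<Longrightarrow> (\<Sum>K\<in>D. dist (f (Inf K)) (f (Sup K))) < e/2"
      using absolutely_continuous_onD[OF ac half_gt_zero[OF e]] by blast
    obtain G where G: "open G" "N \<subseteq> G" "G - N \<in> lmeasurable" "emeasure lebesgue (G - N) < ennreal \<delta>"
      using sets_lebesgue_outer_open[OF negligible_imp_sets[OF N] \<delta>(1)] by blast
    have GN: "(G - N) \<union> N = G" using G(2) by blast
    have Glm: "G \<in> lmeasurable"
      using fmeasurable.Un[OF G(3) negligible_imp_measurable[OF N]] GN by simp
    have "measure lebesgue G = measure lebesgue (G - N)"
      using Glm N by (simp add: measure_Diff_null_set negligible_iff_null_sets fmeasurableD)
    also have "\<dots> < \<delta>"
      using G(3,4) \<delta>(1) by (metis emeasure_eq_measure2 ennreal_less_iff measure_nonneg)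
    finally have Gm: "measure lebesgue G < \<delta>" .
    have "\<exists>d>0. \<forall>y\<in>{a..b}. norm (y - t) < d \<longrightarrow> norm (f y - f t - (y - t) *\<^sub>R g t) \<le> e' * norm (y - t)"
      if "t \<in> {a..b} - N" for t
      using deriv[OF that] e' unfolding has_vector_derivative_def has_derivative_within_alt by blast
    then obtain d where d: "\<And>t. t \<in> {a..b} - N \<Longrightarrow> d t > 0"
      "\<And>t y. t \<in> {a..b} - N \<Longrightarrow> y \<in> {a..b} \<Longrightarrow> norm (y - t) < d t \<Longrightarrow> norm (f y - f t - (y - t) *\<^sub>R g t) \<le> e' * norm (y - t)"
      by metis
    \<comment> \<open>Intervals tagged in \<open>N\<close> stay in the small set \<open>G\<close>, where absolute continuity bounds the increments
      of \<open>f\<close>; the others are handled by differentiability.\<close>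
    define \<gamma> where "\<gamma> = (\<lambda>t. if t \<in> N then G else if t \<in> {a..b} then ball t (d t) else UNIV)"
    have "gauge \<gamma>" unfolding gauge_def \<gamma>_def using G d(1) by (auto simp: subset_iff)
    moreover have "norm ((\<Sum>(x, k)\<in>p. measure lborel k *\<^sub>R g' x) - (f b - f a)) < e"
      if p: "p tagged_division_of {a..b}" and fine: "\<gamma> fine p" for p
    proof -
      have fin: "finite p" using p by auto
      define P where "P = (\<lambda>(x, K). measure lborel K *\<^sub>R g' x - (f (Sup K) - f (Inf K)))"
      define p1 where "p1 = {q\<in>p. fst q \<in> N}"
      have elem: "\<exists>u v. K = {u..v} \<and> u \<le> v \<and> a \<le> u \<and> v \<le> b \<and> x \<in> {u..v}" if "(x, K) \<in> p" for x K
      proof -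
        have "x \<in> K" "K \<subseteq> {a..b}" "\<exists>u v. K = cbox u v" using tagged_division_ofD(2-4)[OF p that] by auto
        then show ?thesis by fastforce
      qed
      have "(\<Sum>(x, k)\<in>p. measure lborel k *\<^sub>R g' x) - (f b - f a) = sum P p"
        unfolding additive_tagged_division_1[OF ab p, symmetric]
        by (simp add: P_def sum_subtractf[symmetric] case_prod_unfold)
      also have "\<dots> = sum P (p - p1) + sum P p1"
        by (rule sum.subset_diff) (auto simp: p1_def fin)
      also have "norm \<dots> \<le> sum (\<lambda>q. norm (P q)) (p - p1) + sum (\<lambda>q. norm (P q)) p1"
        by (meson add_mono norm_triangle_le order_refl sum_norm_le)
      also have "sum (\<lambda>q. norm (P q)) (p - p1) \<le> sum (\<lambda>(x,K). e' * measure lborel K) (p - p1)"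
      proof (rule sum_mono)
        fix q assume q: "q \<in> p - p1"
        obtain x K where qK: "q = (x, K)" by fastforce
        with q have xK: "(x, K) \<in> p" and xN: "x \<notin> N" by (auto simp: p1_def)
        obtain u v where uv: "K = {u..v}" "u \<le> v" "a \<le> u" "v \<le> b" "x \<in> {u..v}"
          using elem[OF xK] by auto
        have xab: "x \<in> {a..b} - N" using uv xN by auto
        have "K \<subseteq> \<gamma> x" using fine xK unfolding fine_def by blast
        then have "K \<subseteq> ball x (d x)" using xab by (simp add: \<gamma>_def)
        then have un: "norm (u - x) < d x" and vn: "norm (v - x) < d x"
          using uv by (force simp: subset_iff dist_real_def abs_minus_commute)+
        \<comment> \<open>Straddling: the tag lies between the endpoints, so the two one-sided
          errors add up to \<open>e'\<close> times the length \<open>v - u\<close>.\<close>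
        have "P q = (f u - f x - (u - x) *\<^sub>R g x) - (f v - f x - (v - x) *\<^sub>R g x)"
          using uv xN by (simp add: P_def qK g'_def algebra_simps)
        also have "norm \<dots> \<le> e' * norm (u - x) + e' * norm (v - x)"
          by (rule order_trans[OF norm_triangle_ineq4 add_mono[OF d(2)[OF xab _ un] d(2)[OF xab _ vn]]])
            (use uv in auto)
        also have "\<dots> = e' * (v - u)" using uv by (simp add: algebra_simps)
        finally show "norm (P q) \<le> (case q of (x, K) \<Rightarrow> e' * measure lborel K)" using uv qK by simp
      qed
      also have "\<dots> \<le> sum (\<lambda>(x,K). e' * measure lborel K) p"
        by (rule sum_mono2) (use fin e' in \<open>auto\<close>)
      also have "\<dots> = e' * (b - a)"
        using additive_content_tagged_division[of p a b] p ab
        by (simp add: sum_distrib_left[symmetric] case_prod_unfold)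
      also have "\<dots> < e / 2"
        using e ab by (simp add: e'_def divide_simps)
      also have "sum (\<lambda>q. norm (P q)) p1 < e/2"
      proof -
        \<comment> \<open>Two tags can share an interval only if it is degenerate, and there
          \<open>\<psi>\<close> vanishes; this allows the sum over tagged pairs to be replaced by
          the sum over the set \<open>D\<close>.\<close>
        define \<psi> where "\<psi> = (\<lambda>K. if K = {} then 0 else dist (f (Inf K)) (f (Sup K)))"
        define D where "D = snd ` p1"
        have p1: "p1 tagged_division_of \<Union>D"
          unfolding D_def
          by (rule tagged_partial_division_of_Union_self, rule tagged_partial_division_subset[of p "{a..b}"])
            (use p in \<open>auto simp: p1_def tagged_division_of_def\<close>)
        then have Ddiv: "D division_of \<Union>D" unfolding D_def by (rule division_of_tagged_division)
        have DK: "K \<subseteq> {a..b} \<and> K \<subseteq> G" if KD: "K \<in> D" for K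
        proof -
          obtain x where x: "(x, K) \<in> p" "x \<in> N" using KD by (auto simp: D_def p1_def)
          have "K \<subseteq> \<gamma> x" using fine x(1) unfolding fine_def by blast
          then show ?thesis using x(2) tagged_division_ofD(3)[OF p x(1)] by (simp add: \<gamma>_def)
        qed
        then have Dsub: "\<Union>D \<subseteq> {a..b}" and "\<Union>D \<subseteq> G" by blast+
        have "(\<Sum>K\<in>D. measure lborel K) = measure lebesgue (\<Union>D)"
          unfolding content_division[OF Ddiv, symmetric]
        proof (rule sum.cong[OF refl])
          fix K assume "K \<in> D"
          then obtain u v where "K = cbox u v" using division_ofD(4)[OF Ddiv] by blast
          then show "measure lborel K = measure lebesgue K" by simp
        qed
        also have "\<dots> \<le> measure lebesgue G"
          using \<open>\<Union>D \<subseteq> G\<close> Glm lmeasurable_division[OF Ddiv] by (intro measure_mono_fmeasurable) auto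
        finally have "(\<Sum>K\<in>D. dist (f (Inf K)) (f (Sup K))) < e/2"
          using Gm by (intro \<delta>(2)[OF Ddiv Dsub]) auto
        moreover have "sum (\<lambda>q. norm (P q)) p1 = (\<Sum>(x,K)\<in>p1. \<psi> K)"
        proof (rule sum.cong[OF refl])
          fix q assume q: "q \<in> p1"
          obtain x K where xK: "q = (x, K)" by fastforce
          then have K: "(x, K) \<in> p" "x \<in> N" using q by (auto simp: p1_def)
          have "K \<noteq> {}" using tagged_division_ofD(2)[OF p K(1)] by blast
          then show "norm (P q) = (case q of (x, K) \<Rightarrow> \<psi> K)"
            using K(2) by (simp add: xK P_def g'_def \<psi>_def dist_norm norm_minus_commute)
        qed
        moreover have "(\<Sum>(x,K)\<in>p1. \<psi> K) = sum \<psi> D"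
          unfolding D_def
        proof (rule sum.over_tagged_division_lemma[OF p1])
          fix u v :: real assume "box u v = {}"
          then have "v \<le> u" by (simp add: box_eq_empty)
          then show "\<psi> (cbox u v) = 0" by (cases "u = v") (simp_all add: \<psi>_def)
        qed
        moreover have "sum \<psi> D = (\<Sum>K\<in>D. dist (f (Inf K)) (f (Sup K)))"
        proof (rule sum.cong[OF refl])
          fix K assume "K \<in> D"
          then show "\<psi> K = dist (f (Inf K)) (f (Sup K))"
            using division_ofD(3)[OF Ddiv] by (simp add: \<psi>_def)
        qed
        ultimately show ?thesis by simp
      qed
      finally show ?thesis by simp
    qed
    ultimately show "\<exists>\<gamma>. gauge \<gamma> \<and> (\<forall>p. p tagged_division_of {a..b} \<and> \<gamma> fine p \<longrightarrow>
        norm ((\<Sum>(x, k)\<in>p. measure lborel k *\<^sub>R g' x) - (f b - f a)) < e)"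
      by (intro exI[of _ \<gamma>]) simp
  qed
  then show ?thesis
    by (rule has_integral_spike[OF N, rotated]) (simp add: g'_def)
qed

subsection \<open>Integral form of the equation\<close>

lemma AE_lebesgue_on_negligible:
  fixes S :: "'a::euclidean_space set"
  assumes "S \<in> sets lebesgue"
  shows "(AE t in lebesgue_on S. P t) \<longleftrightarrow> (\<exists>N. negligible N \<and> (\<forall>t\<in>S - N. P t))"
  using assms by (subst AE_restrict_space_iff) (auto simp: eventually_ae_filter_negligible)

text \<open>Lebesgue differentiation. Averages over \<open>[x, x + h]\<close> converge almost
  everywhere; the same fact for the reflected function yields averages over
  \<open>[x - h, x]\<close>, and together they give the two-sided derivative.\<close>

lemma integral_has_vector_derivative_AE:
  fixes f :: "real \<Rightarrow> 'a::euclidean_space"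
  assumes f: "f integrable_on {a..b}"
  obtains N where "negligible N"
    "\<And>t. t \<in> {a..b} - N \<Longrightarrow> ((\<lambda>t. integral {a..t} f) has_vector_derivative f t) (at t within {a..b})"
proof -
  define g where "g = (\<lambda>t. if t \<in> {a..b} then f t else 0)"
  have gi: "g integrable_on {c..d}" for c d
  proof -
    have "g integrable_on UNIV" unfolding g_def using f by (simp only: integrable_restrict_UNIV)
    then show ?thesis by (rule integrable_on_subinterval) auto
  qed
  have gr: "(\<lambda>t. g (-t)) integrable_on {c..d}" for c d
    using gi[of "-d" "-c"] Henstock_Kurzweil_Integration.integrable_reflect_real[where f=g and a="-d" and b="-c"] by simp
  obtain N1 where N1: "negligible N1" "\<And>x e. x \<notin> N1 \<Longrightarrow> 0 < e \<Longrightarrow>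
      \<exists>d>0. \<forall>h. 0 < h \<and> h < d \<longrightarrow> norm (integral {x..x+h} g /\<^sub>R h - g x) < e"
    using integrable_ccontinuous_explicit[of g] gi by (auto simp: cbox_interval)
  obtain N2 where N2: "negligible N2" "\<And>x e. x \<notin> N2 \<Longrightarrow> 0 < e \<Longrightarrow>
      \<exists>d>0. \<forall>h. 0 < h \<and> h < d \<longrightarrow> norm (integral {x..x+h} (\<lambda>t. g (-t)) /\<^sub>R h - g (-x)) < e"
    using integrable_ccontinuous_explicit[of "\<lambda>t. g (-t)"] gr by (auto simp: cbox_interval)
  \<comment> \<open>\<open>N2\<close> lives on the reflected line and is carried back by negation;
    without the endpoints both one-sided averages are available.\<close>
  define N where "N = N1 \<union> uminus ` N2 \<union> {a, b}"
  have "negligible (uminus ` N2)"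
    using N2(1) by (intro negligible_differentiable_image_negligible differentiable_on_minus differentiable_on_ident) simp_all
  then have "negligible N" using N1 by (simp add: N_def)
  moreover have "((\<lambda>t. integral {a..t} f) has_vector_derivative f t) (at t within {a..b})"
    if t: "t \<in> {a..b} - N" for t
    unfolding has_vector_derivative_def has_derivative_within_alt
  proof (intro conjI allI impI bounded_linear_scaleR_left)
    fix e :: real assume e: "e > 0"
    have t1: "t \<notin> N1" and t2: "-t \<notin> N2" and ab: "a < t" "t < b"
      using t by (force simp: N_def)+
    obtain d1 where d1: "d1 > 0" "\<And>h. 0 < h \<Longrightarrow> h < d1 \<Longrightarrow> norm (integral {t..t+h} g /\<^sub>R h - g t) < e"
      using N1(2)[OF t1 e] by blast
    obtain d2 where d2: "d2 > 0" "\<And>h. 0 < h \<Longrightarrow> h < d2 \<Longrightarrow> norm (integral {-t..-t+h} (\<lambda>t. g (-t)) /\<^sub>R h - g t) < e"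
      using N2(2)[OF t2 e] by auto
    have scale: "norm (I - h *\<^sub>R g t) \<le> e * h" if "norm (I /\<^sub>R h - g t) < e" "h > 0" for I h
    proof -
      have "I - h *\<^sub>R g t = h *\<^sub>R (I /\<^sub>R h - g t)" using that by (simp add: algebra_simps)
      then have "norm (I - h *\<^sub>R g t) = h * norm (I /\<^sub>R h - g t)" using that by simp
      then show ?thesis using that by (simp add: mult.commute)
    qed
    have fg: "integral {u..v} f = integral {u..v} g" if "a \<le> u" "v \<le> b" for u v
      by (rule integral_cong) (use that in \<open>auto simp: g_def\<close>)
    have comb: "integral {a..v} f - integral {a..u} f = integral {u..v} f" if "a \<le> u" "u \<le> v" "v \<le> b" for u v
      using Henstock_Kurzweil_Integration.integral_combine[of a u v f] that
        integrable_on_subinterval[OF f, of a v] by (simp add: algebra_simps)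
    have "norm (integral {a..y} f - integral {a..t} f - (y - t) *\<^sub>R f t) \<le> e * norm (y - t)"
      if y: "y \<in> {a..b}" "norm (y - t) < min d1 d2" for y
    proof (cases y t rule: linorder_cases)
      case equal then show ?thesis by simp
    next
      case greater
      then have "norm (integral {t..y} g - (y - t) *\<^sub>R g t) \<le> e * (y - t)"
        using d1(2)[of "y - t"] y by (intro scale) auto
      then show ?thesis using comb[of t y] fg[of t y] y greater ab by (simp add: g_def)
    next
      case less
      have "integral {-t..-t+(t-y)} (\<lambda>t. g (-t)) = integral {y..t} g"
        using Henstock_Kurzweil_Integration.integral_reflect_real[where f=g and a=y and b=t] by simp
      then have "norm (integral {y..t} g - (t - y) *\<^sub>R g t) \<le> e * (t - y)"
        using d2(2)[of "t - y"] y less by (intro scale) auto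
      moreover have "integral {a..y} f - integral {a..t} f - (y - t) *\<^sub>R f t = - (integral {y..t} g - (t - y) *\<^sub>R g t)"
        using comb[of y t] fg[of y t] y less ab by (simp add: g_def algebra_simps)
      ultimately show ?thesis using less by (simp only: norm_minus_cancel) simp
    qed
    then show "\<exists>d>0. \<forall>y\<in>{a..b}. norm (y - t) < d \<longrightarrow>
        norm (integral {a..y} f - integral {a..t} f - (y - t) *\<^sub>R f t) \<le> e * norm (y - t)"
      using d1(1) d2(1) by (intro exI[of _ "min d1 d2"]) auto
  qed
  ultimately show thesis by (rule that)
qed

text \<open>Caratheodory solutions in integral form. This form restricts, concatenates and shifts in
  time without any handling of exceptional null sets; absolute continuity is recovered from the
  Caratheodory bound.\<close>

definition integral_solution ::
    "(real \<Rightarrow> real^2 \<Rightarrow> real^2) \<Rightarrow> real \<Rightarrow> real \<Rightarrow> (real \<Rightarrow> real^2) \<Rightarrow> bool" where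
  "integral_solution F a b x \<longleftrightarrow> (\<forall>t\<in>{a..b}. ((\<lambda>s. F s (x s)) has_integral (x t - x a)) {a..t})"

lemma integral_solution_cong:
  assumes "integral_solution F a b x" "\<And>t. t \<in> {a..b} \<Longrightarrow> x t = y t"
  shows "integral_solution F a b y"
  unfolding integral_solution_def
proof
  fix t assume t: "t \<in> {a..b}"
  have "((\<lambda>s. F s (x s)) has_integral (x t - x a)) {a..t}"
    using assms(1) t by (auto simp: integral_solution_def)
  then have "((\<lambda>s. F s (y s)) has_integral (x t - x a)) {a..t}"
    by (rule has_integral_eq[rotated]) (use t assms(2) in auto)
  then show "((\<lambda>s. F s (y s)) has_integral (y t - y a)) {a..t}"
    using assms(2)[of t] assms(2)[of a] t by simp
qed

lemma integral_solution_has_integral: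
  assumes "integral_solution F a b x" "a \<le> u" "u \<le> v" "v \<le> b"
  shows "((\<lambda>s. F s (x s)) has_integral (x v - x u)) {u..v}"
proof -
  have 1: "((\<lambda>s. F s (x s)) has_integral (x v - x a)) {a..v}" and 2: "((\<lambda>s. F s (x s)) has_integral (x u - x a)) {a..u}"
    using assms by (auto simp: integral_solution_def)
  have "(\<lambda>s. F s (x s)) integrable_on {u..v}"
    by (rule integrable_on_subinterval[OF has_integral_integrable[OF 1]]) (use assms in auto)
  then obtain I where I: "((\<lambda>s. F s (x s)) has_integral I) {u..v}" by blast
  have "((\<lambda>s. F s (x s)) has_integral (x u - x a) + I) {a..v}"
    by (rule has_integral_combine[OF _ _ 2 I]) (use assms in auto)
  then have "(x u - x a) + I = x v - x a" using 1 has_integral_unique by blast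
  then have "I = x v - x u" by (simp add: algebra_simps)
  then show ?thesis using I by simp
qed

lemma integral_solution_subinterval:
  assumes "integral_solution F a b x" "a \<le> c" "d \<le> b"
  shows "integral_solution F c d x"
  unfolding integral_solution_def using assms integral_solution_has_integral by auto

lemma integral_solution_combine:
  assumes 1: "integral_solution F a c x" and 2: "integral_solution F c b x" and "a \<le> c" "c \<le> b"
  shows "integral_solution F a b x"
  unfolding integral_solution_def
proof
  fix t assume t: "t \<in> {a..b}"
  show "((\<lambda>s. F s (x s)) has_integral (x t - x a)) {a..t}"
  proof (cases "t \<le> c")
    case True then show ?thesis using 1 t by (auto simp: integral_solution_def)
  next
    case False
    have "((\<lambda>s. F s (x s)) has_integral (x c - x a) + (x t - x c)) {a..t}"
      by (rule has_integral_combine[of a c t])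
        (use 1 2 assms(3,4) False t in \<open>auto simp: integral_solution_def\<close>)
    then show ?thesis by simp
  qed
qed

lemma integral_solution_eq:
  assumes "integral_solution F a b x" "t \<in> {a..b}"
  shows "x t = x a + integral {a..t} (\<lambda>s. F s (x s))"
proof -
  have "((\<lambda>s. F s (x s)) has_integral (x t - x a)) {a..t}"
    using assms by (auto simp: integral_solution_def)
  then show ?thesis by (simp add: integral_unique)
qed

lemma integral_solution_continuous:
  assumes "integral_solution F a b x"
  shows "continuous_on {a..b} x"
proof (cases "a \<le> b")
  case True
  have "(\<lambda>s. F s (x s)) integrable_on {a..b}"
    using assms True unfolding integral_solution_def by (meson atLeastAtMost_iff has_integral_integrable order_refl)
  then have "continuous_on {a..b} (\<lambda>t. x a + integral {a..t} (\<lambda>s. F s (x s)))"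
    by (intro continuous_intros indefinite_integral_continuous_1)
  then show ?thesis
    by (rule continuous_on_eq) (rule integral_solution_eq[OF assms, symmetric])
qed auto

lemma solution_on_imp_integral_solution:
  assumes "solution_on F I x" "{a..b} \<subseteq> I"
  shows "integral_solution F a b x"
  unfolding integral_solution_def
proof
  fix t assume t: "t \<in> {a..b}"
  have I: "I \<in> sets lebesgue"
    using real_interval_borel_measurable assms(1) unfolding solution_on_def by fastforce
  obtain N where N: "negligible N" "\<And>s. s \<in> I - N \<Longrightarrow> (x has_vector_derivative F s (x s)) (at s within I)"
    using assms(1) unfolding solution_on_def AE_lebesgue_on_negligible[OF I] by blast
  have "{a..t} \<subseteq> {a..b}" using t by auto
  then have sub: "{a..t} \<subseteq> I" using assms(2) by blast
  show "((\<lambda>s. F s (x s)) has_integral (x t - x a)) {a..t}"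
  proof (rule absolutely_continuous_on_FTC[OF _ _ N(1)])
    show "absolutely_continuous_on {a..t} x" using assms(1) sub by (auto simp: solution_on_def)
    show "(x has_vector_derivative F s (x s)) (at s within {a..t})" if "s \<in> {a..t} - N" for s
      by (rule has_vector_derivative_within_subset[OF N(2) sub]) (use that sub in auto)
  qed (use t in auto)
qed

lemma caratheodory_bound:
  assumes "caratheodory F" "compact K"
  obtains m :: "real \<Rightarrow> real" and N where "m absolutely_integrable_on {a..b}" "negligible N"
    "\<And>t z. t \<in> {a..b} - N \<Longrightarrow> z \<in> K \<Longrightarrow> norm (F t z) \<le> m t"
proof -
  obtain m :: "real \<Rightarrow> real" where m: "m absolutely_integrable_on {a..b}"
    "AE t in lebesgue_on {a..b}. \<forall>z\<in>K. norm (F t z) \<le> m t"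
    using assms unfolding caratheodory_def by blast
  then show thesis using that by (auto simp: AE_lebesgue_on_negligible)
qed

text \<open>A solution has compact range on \<open>{a..b}\<close>, so the Caratheodory conditions
  supply an integrable majorant, which upgrades gauge integrability to absolute
  integrability.\<close>

lemma integral_solution_absolutely_integrable:
  assumes F: "caratheodory F" and x: "integral_solution F a b x" and ab: "a \<le> b"
  shows "(\<lambda>s. F s (x s)) absolutely_integrable_on {a..b}"
proof -
  define f where "f = (\<lambda>s. F s (x s))"
  have fi: "f integrable_on {a..b}"
    using x ab unfolding integral_solution_def f_def by (meson atLeastAtMost_iff has_integral_integrable order_refl)
  have "compact (x ` {a..b})"
    using integral_solution_continuous[OF x] by (intro compact_continuous_image) auto
  then obtain m :: "real \<Rightarrow> real" and N where m: "m absolutely_integrable_on {a..b}" "negligible N"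
    "\<And>t z. t \<in> {a..b} - N \<Longrightarrow> z \<in> x ` {a..b} \<Longrightarrow> norm (F t z) \<le> m t"
    by (metis caratheodory_bound[OF F])
  define f' where "f' = (\<lambda>s. if s \<in> N then 0 else f s)"
  have f'i: "f' integrable_on {a..b}"
    by (rule integrable_spike[OF fi m(2)]) (auto simp: f'_def)
  have "(\<lambda>s. \<bar>m s\<bar>) integrable_on {a..b}"
    using m(1) by (auto simp: absolutely_integrable_on_def)
  then have "f' absolutely_integrable_on {a..b}"
    by (rule absolutely_integrable_integrable_bound[rotated 2])
      (use f'i m(3) in \<open>auto simp: f'_def f_def intro: order_trans[OF _ abs_ge_self]\<close>)
  then have "f absolutely_integrable_on {a..b}"
    by (rule absolutely_integrable_spike[OF _ m(2)]) (auto simp: f'_def)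
  then show ?thesis by (simp add: f_def)
qed

lemma integral_solution_imp_solution_on:
  assumes F: "caratheodory F" and x: "integral_solution F a b x"
  shows "solution_on F {a..b} x"
proof (cases "a \<le> b")
  case False
  then show ?thesis by (auto simp: solution_on_def absolutely_continuous_on_def)
next
  case True
  define f where "f = (\<lambda>s. F s (x s))"
  have fai: "f absolutely_integrable_on {a..b}"
    unfolding f_def by (rule integral_solution_absolutely_integrable[OF F x True])
  have fi: "f integrable_on {a..b}" using set_lebesgue_integral_eq_integral(1)[OF fai] .
  have xf: "x a + integral {a..t} f = x t" if "t \<in> {a..b}" for t
    using integral_solution_eq[OF x that, symmetric] unfolding f_def .
  have "absolutely_continuous_on {a..b} x"
    by (rule absolutely_continuous_on_cong[OF absolutely_continuous_on_integral[OF fai] xf])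
  then have ac: "absolutely_continuous_on {c..d} x" if "{c..d} \<subseteq> {a..b}" for c d
    using absolutely_continuous_on_subset that by blast
  obtain N' where N': "negligible N'"
    "\<And>t. t \<in> {a..b} - N' \<Longrightarrow> ((\<lambda>t. integral {a..t} f) has_vector_derivative f t) (at t within {a..b})"
    using integral_has_vector_derivative_AE[OF fi] by blast
  have "(x has_vector_derivative f t) (at t within {a..b})" if "t \<in> {a..b} - N'" for t
  proof -
    have "((\<lambda>t. x a + integral {a..t} f) has_vector_derivative f t) (at t within {a..b})"
      using has_vector_derivative_add[OF has_vector_derivative_const[of "x a"] N'(2)[OF that]] by simp
    then show ?thesis
      by (rule has_vector_derivative_transform[rotated 2]) (use xf that in auto)
  qed
  then show ?thesis
    using ac N'(1) by (auto simp: solution_on_def AE_lebesgue_on_negligible f_def)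
qed

subsection \<open>Integrably bounded systems\<close>

text \<open>The shape of \<open>F\<close> after truncation. Continuity and the bound hold at every
  time, not just almost every one, and the bound is independent of the state, so solutions exist on
  the whole interval.\<close>

locale bounded_system =
  fixes G :: "real \<Rightarrow> real^2 \<Rightarrow> real^2" and m :: "real \<Rightarrow> real" and a b :: real
  assumes ab: "a \<le> b"
    and measurable_G: "\<And>z. (\<lambda>t. G t z) \<in> borel_measurable lebesgue"
    and continuous_G: "\<And>t. continuous_on UNIV (G t)"
    and m_integrable: "m integrable_on {a..b}"
    and G_bound: "\<And>t z. t \<in> {a..b} \<Longrightarrow> norm (G t z) \<le> m t"
begin

text \<open>Approximate \<open>y\<close> pointwise by simple functions. For these the composite is
  pieced together from countably many measurable maps, and continuity in the state variable carries
  measurability to the limit.\<close>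

lemma measurable_G_comp:
  assumes y: "y \<in> borel_measurable lebesgue"
  shows "(\<lambda>s. G s (y s)) \<in> borel_measurable lebesgue"
proof -
  obtain f where f: "\<And>i. simple_function lebesgue (f i)" "\<And>s. s \<in> space lebesgue \<Longrightarrow> (\<lambda>i. f i s) \<longlonglongrightarrow> y s"
    using borel_measurable_implies_sequence_metric[OF y, of 0] by blast
  show ?thesis
  proof (rule borel_measurable_LIMSEQ_metric)
    fix i
    have c: "countable (range (f i))"
      using simple_functionD(1)[OF f(1)[of i]] by (simp add: countable_finite)
    then have "f i \<in> measurable lebesgue (count_space (range (f i)))"
      using simple_functionD(2)[OF f(1)[of i]] by (simp add: measurable_count_space_eq_countable)
    from measurable_compose_countable'[OF measurable_G this c]
    show "(\<lambda>s. G s (f i s)) \<in> borel_measurable lebesgue" .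
  next
    fix s :: real
    show "(\<lambda>i. G s (f i s)) \<longlonglongrightarrow> G s (y s)"
      using continuous_G[of s] f(2)[of s] by (auto simp: continuous_on_eq_continuous_at intro: isCont_tendsto_compose)
  qed
qed

lemma absolutely_integrable_G:
  assumes y: "continuous_on {a..b} y"
  shows "(\<lambda>s. G s (y s)) absolutely_integrable_on {a..b}"
proof -
  define y' where "y' = (\<lambda>s. if s \<in> {a..b} then y s else 0)"
  have "y' \<in> borel_measurable lebesgue" unfolding y'_def
    by (intro borel_measurable_if_I continuous_imp_measurable_on_sets_lebesgue y) auto
  then have "(\<lambda>s. G s (y' s)) \<in> borel_measurable (lebesgue_on {a..b})"
    by (intro measurable_restrict_space1 measurable_G_comp)
  then have "(\<lambda>s. G s (y' s)) absolutely_integrable_on {a..b}"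
    by (rule measurable_bounded_by_integrable_imp_absolutely_integrable)
      (use m_integrable G_bound in auto)
  then show ?thesis
    by (rule absolutely_integrable_spike[of _ _ "{}"]) (auto simp: y'_def)
qed

lemma integrable_G:
  assumes "continuous_on {a..b} y" "a \<le> u" "v \<le> b"
  shows "(\<lambda>s. G s (y s)) integrable_on {u..v}"
  using integrable_on_subinterval[OF set_lebesgue_integral_eq_integral(1)[OF absolutely_integrable_G[OF assms(1)]]]
    assms(2,3) by auto

definition V :: "(real \<Rightarrow> real^2) \<Rightarrow> real \<Rightarrow> real^2" where
  "V y t = integral {a..t} (\<lambda>s. G s (y s))"

definition M :: "real \<Rightarrow> real" where "M t = integral {a..t} m"

lemma V_diff:
  assumes "continuous_on {a..b} y" "a \<le> u" "u \<le> v" "v \<le> b"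
  shows "V y v - V y u = integral {u..v} (\<lambda>s. G s (y s))"
  using Henstock_Kurzweil_Integration.integral_combine[OF assms(2,3) integrable_G[OF assms(1) _ assms(4)]]
  by (simp add: V_def algebra_simps)

lemma continuous_M: "continuous_on {a..b} M"
  unfolding M_def using m_integrable by (rule indefinite_integral_continuous_1)

text \<open>The bound is free of \<open>y\<close>: all functions \<open>V y\<close> share the
  modulus of continuity of \<open>M\<close>. This is the equicontinuity behind the Arzela-Ascoli
  argument.\<close>

lemma V_diff_le:
  assumes y: "continuous_on {a..b} y" and uv: "u \<in> {a..b}" "v \<in> {a..b}"
  shows "norm (V y v - V y u) \<le> \<bar>M v - M u\<bar>"
proof -
  have *: "norm (V y v - V y u) \<le> \<bar>M v - M u\<bar>" if "a \<le> u" "u \<le> v" "v \<le> b" for u v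
  proof -
    have mi: "m integrable_on {c..d}" if "a \<le> c" "d \<le> b" for c d
      using integrable_on_subinterval[OF m_integrable] that by auto
    have "norm (V y v - V y u) \<le> integral {u..v} m"
      unfolding V_diff[OF y that]
      by (rule integral_norm_bound_integral[OF integrable_G[OF y] mi]) (use that G_bound in auto)
    also have "\<dots> = M v - M u"
      using Henstock_Kurzweil_Integration.integral_combine[of a u v m] mi[of a v] that
      by (simp add: M_def algebra_simps)
    finally show ?thesis by simp
  qed
  show ?thesis
    using *[of u v] *[of v u] uv by (cases "u \<le> v") (auto simp: norm_minus_commute abs_minus_commute)
qed

lemma continuous_V:
  assumes "continuous_on {a..b} y"
  shows "continuous_on {a..b} (V y)"
  unfolding V_def[abs_def] using integrable_G[OF assms, of a b] by (intro indefinite_integral_continuous_1) auto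

text \<open>With \<open>\<delta> k s = s\<close> this gives continuous dependence, with genuine delays it makes Tonelli's
  approximate solutions converge.\<close>

lemma delayed_solutions_compact:
  assumes y: "\<And>k. continuous_on {a..b} (y k)"
    and \<delta>: "\<And>k. continuous_on {a..b} (\<delta> k)" "\<And>k s. s \<in> {a..b} \<Longrightarrow> \<delta> k s \<in> {a..b}"
      "\<And>s. s \<in> {a..b} \<Longrightarrow> (\<lambda>k. \<delta> k s) \<longlonglongrightarrow> s"
    and \<tau>: "\<And>k. \<tau> k \<in> {a..b}" "\<tau> \<longlonglongrightarrow> \<tau>0" and z: "z \<longlonglongrightarrow> z0"
    and eq: "\<And>k t. t \<in> {a..b} \<Longrightarrow> y k t = z k + V (\<lambda>s. y k (\<delta> k s)) t - V (\<lambda>s. y k (\<delta> k s)) (\<tau> k)"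
  obtains r w where "strict_mono r" "continuous_on {a..b} w" "uniform_limit {a..b} (\<lambda>k. y (r k)) w sequentially"
    "\<And>t. t \<in> {a..b} \<Longrightarrow> w t = z0 + V w t - V w \<tau>0"
proof -
  have cy: "continuous_on {a..b} (\<lambda>s. y k (\<delta> k s))" for k
    using continuous_on_compose2[OF y \<delta>(1)] \<delta>(2) by blast
  have ydiff: "norm (y k t - y k u) \<le> \<bar>M t - M u\<bar>" if "t \<in> {a..b}" "u \<in> {a..b}" for k t u
    using V_diff_le[OF cy that(2,1)] eq[OF that(1)] eq[OF that(2)] by simp
  obtain B where B: "\<And>k. norm (z k) \<le> B"
    using convergent_imp_bounded[OF z] by (auto simp: bounded_iff)
  obtain C where "\<forall>x\<in>M ` {a..b}. norm x \<le> C"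
    using compact_imp_bounded[OF compact_continuous_image[OF continuous_M]] unfolding bounded_iff by auto
  then have C: "\<bar>M t\<bar> \<le> C" if "t \<in> {a..b}" for t using that by simp
  have \<tau>0: "\<tau>0 \<in> {a..b}"
    using closed_sequentially[OF closed_atLeastAtMost _ \<tau>(2)] \<tau>(1) by blast
  have bnd: "norm (y k t) \<le> B + 2 * C" if t: "t \<in> {a..b}" for k t
  proof -
    have "norm (y k t) \<le> norm (z k) + norm (V (\<lambda>s. y k (\<delta> k s)) t - V (\<lambda>s. y k (\<delta> k s)) (\<tau> k))"
      unfolding eq[OF t] add_diff_eq[symmetric] by (rule norm_triangle_ineq)
    then show ?thesis
      using V_diff_le[OF cy[of k] \<tau>(1)[of k] t] B[of k] C[OF t] C[OF \<tau>(1)[of k]] by linarith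
  qed
  have equi: "\<exists>d>0. \<forall>n t. t \<in> {a..b} \<and> norm (u - t) < d \<longrightarrow> norm (y n u - y n t) < e"
    if u: "u \<in> {a..b}" and e: "e > 0" for u e
  proof -
    obtain d where d: "d > 0" "\<And>t. t \<in> {a..b} \<Longrightarrow> dist t u < d \<Longrightarrow> dist (M t) (M u) < e"
      using continuous_M u e unfolding continuous_on_iff by blast
    have "norm (y n u - y n t) < e" if "t \<in> {a..b}" "norm (u - t) < d" for n t
      using ydiff[OF u that(1), of n] d(2)[OF that(1)] that(2) by (simp add: dist_real_def abs_minus_commute)
    then show ?thesis using d(1) by blast
  qed
  obtain w r where w: "continuous_on {a..b} w" and r: "strict_mono (r :: nat \<Rightarrow> nat)"
    and lim: "\<And>e. 0 < e \<Longrightarrow> \<exists>N. \<forall>n t. n \<ge> N \<and> t \<in> {a..b} \<longrightarrow> norm (y (r n) t - w t) < e"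
    using Arzela_Ascoli[OF compact_Icc bnd equi] by metis
  have ul: "uniform_limit {a..b} (\<lambda>k. y (r k)) w sequentially"
    unfolding uniform_limit_iff eventually_sequentially dist_norm using lim by blast
  have ptw: "(\<lambda>k. y (r k) (\<delta> (r k) s)) \<longlonglongrightarrow> w s" if s: "s \<in> {a..b}" for s
  proof -
    have "(\<lambda>k. \<delta> (r k) s) \<longlonglongrightarrow> s"
      using LIMSEQ_subseq_LIMSEQ[OF \<delta>(3)[OF s] r] by (simp add: o_def)
    then have "(\<lambda>k. w (\<delta> (r k) s)) \<longlonglongrightarrow> w s"
      by (rule continuous_on_tendsto_compose[OF w _ s]) (use \<delta>(2)[OF s] in simp)
    moreover have "(\<lambda>k. y (r k) (\<delta> (r k) s) - w (\<delta> (r k) s)) \<longlonglongrightarrow> 0"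
      unfolding LIMSEQ_iff
    proof (intro allI impI)
      fix e :: real assume "e > 0"
      then show "\<exists>N. \<forall>n\<ge>N. norm (y (r n) (\<delta> (r n) s) - w (\<delta> (r n) s) - 0) < e"
        using lim \<delta>(2)[OF s] by (metis diff_zero)
    qed
    ultimately show ?thesis using tendsto_add by fastforce
  qed
  have Vlim: "(\<lambda>k. V (\<lambda>s. y (r k) (\<delta> (r k) s)) t) \<longlonglongrightarrow> V w t" if t: "t \<in> {a..b}" for t
    unfolding V_def
  proof (rule dominated_convergence(2))
    show "(\<lambda>s. G s (y (r k) (\<delta> (r k) s))) integrable_on {a..t}" for k
      using integrable_G[OF cy] t by auto
    show "m integrable_on {a..t}" using integrable_on_subinterval[OF m_integrable] t by auto
    show "norm (G s (y (r k) (\<delta> (r k) s))) \<le> m s" if "s \<in> {a..t}" for k s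
      using G_bound that t by auto
    show "(\<lambda>k. G s (y (r k) (\<delta> (r k) s))) \<longlonglongrightarrow> G s (w s)" if "s \<in> {a..t}" for s
      using continuous_G[of s] ptw[of s] t that
      by (auto simp: continuous_on_eq_continuous_at intro: isCont_tendsto_compose)
  qed
  \<comment> \<open>\<open>Vlim\<close> gives convergence at a fixed time only, so the moving base
    time is first compared with \<open>\<tau>0\<close> through \<open>M\<close>, uniformly in
    \<open>k\<close>.\<close>
  have "(\<lambda>k. V (\<lambda>s. y (r k) (\<delta> (r k) s)) (\<tau> (r k)) - V (\<lambda>s. y (r k) (\<delta> (r k) s)) \<tau>0) \<longlonglongrightarrow> 0"
  proof (rule Lim_null_comparison)
    show "\<forall>\<^sub>F k in sequentially. norm (V (\<lambda>s. y (r k) (\<delta> (r k) s)) (\<tau> (r k)) - V (\<lambda>s. y (r k) (\<delta> (r k) s)) \<tau>0)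
       \<le> \<bar>M (\<tau> (r k)) - M \<tau>0\<bar>"
      using V_diff_le[OF cy \<tau>0 \<tau>(1)] by simp
    have "(\<lambda>k. \<tau> (r k)) \<longlonglongrightarrow> \<tau>0" using LIMSEQ_subseq_LIMSEQ[OF \<tau>(2) r] by (simp add: o_def)
    then have "(\<lambda>k. M (\<tau> (r k))) \<longlonglongrightarrow> M \<tau>0"
      by (rule continuous_on_tendsto_compose[OF continuous_M _ \<tau>0]) (use \<tau>(1) in simp)
    then have "(\<lambda>k. M (\<tau> (r k)) - M \<tau>0) \<longlonglongrightarrow> 0" by (simp add: LIM_zero)
    then show "(\<lambda>k. \<bar>M (\<tau> (r k)) - M \<tau>0\<bar>) \<longlonglongrightarrow> 0" by (rule tendsto_rabs_zero)
  qed
  from tendsto_add[OF this Vlim[OF \<tau>0]]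
  have V\<tau>: "(\<lambda>k. V (\<lambda>s. y (r k) (\<delta> (r k) s)) (\<tau> (r k))) \<longlonglongrightarrow> V w \<tau>0" by simp
  have "w t = z0 + V w t - V w \<tau>0" if t: "t \<in> {a..b}" for t
  proof (rule LIMSEQ_unique)
    show "(\<lambda>k. y (r k) t) \<longlonglongrightarrow> w t" using tendsto_uniform_limitI[OF ul t] .
    have "(\<lambda>k. z (r k)) \<longlonglongrightarrow> z0" using LIMSEQ_subseq_LIMSEQ[OF z r] by (simp add: o_def)
    from tendsto_diff[OF tendsto_add[OF this Vlim[OF t]] V\<tau>]
    show "(\<lambda>k. y (r k) t) \<longlonglongrightarrow> z0 + V w t - V w \<tau>0" using eq[OF t] by simp
  qed
  with r w ul show thesis by (rule that)
qed

lemma solution_exists: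
  assumes \<tau>0: "\<tau>0 \<in> {a..b}"
  obtains w where "continuous_on {a..b} w" "\<And>t. t \<in> {a..b} \<Longrightarrow> w t = z0 + V w t - V w \<tau>0"
proof -
  define h where "h = (\<lambda>n::nat. inverse (real (Suc n)))"
  have h: "h n > 0" for n by (simp add: h_def)
  \<comment> \<open>Tonelli's scheme in both time directions: \<open>\<delta> n s\<close> is \<open>s\<close> moved towards \<open>\<tau>0\<close> by at most \<open>h n\<close>, so the
    delayed equation is solved by iterating outwards from \<open>\<tau>0\<close> in steps of length \<open>h n\<close>.\<close>
  define \<delta> where "\<delta> = (\<lambda>n s. \<tau>0 + max 0 (s - \<tau>0 - h n) - max 0 (\<tau>0 - s - h n))"
  have \<delta>c: "continuous_on {a..b} (\<delta> n)" for n
    unfolding \<delta>_def by (intro continuous_intros)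
  have \<delta>ab: "\<delta> n s \<in> {a..b}" if "s \<in> {a..b}" for n s
    using that \<tau>0 h[of n] by (auto simp: \<delta>_def max_def)
  have \<delta>d: "\<bar>\<delta> n s - s\<bar> \<le> h n" "\<bar>\<delta> n s - \<tau>0\<bar> \<le> max 0 (\<bar>s - \<tau>0\<bar> - h n)" for n s
    using h[of n] by (auto simp: \<delta>_def max_def)
  have \<delta>lim: "(\<lambda>n. \<delta> n s) \<longlonglongrightarrow> s" for s
  proof -
    have "(\<lambda>n. \<delta> n s - s) \<longlonglongrightarrow> 0"
      by (rule Lim_null_comparison[OF _ LIMSEQ_inverse_real_of_nat]) (use \<delta>d(1) in \<open>simp add: h_def\<close>)
    then show ?thesis by (simp add: LIM_zero_iff)
  qed
  have "\<exists>y. continuous_on {a..b} y \<and> (\<forall>t\<in>{a..b}. y t = z0 + V (\<lambda>s. y (\<delta> n s)) t - V (\<lambda>s. y (\<delta> n s)) \<tau>0)" for n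
  proof -
    define A where "A = (\<lambda>y t. z0 + V (\<lambda>s. y (\<delta> n s)) t - V (\<lambda>s. y (\<delta> n s)) \<tau>0)"
    have cd: "continuous_on {a..b} (\<lambda>s. y (\<delta> n s))" if "continuous_on {a..b} y" for y :: "real \<Rightarrow> real^2"
      using continuous_on_compose2[OF that \<delta>c] \<delta>ab by blast
    have cA: "continuous_on {a..b} (A y)" if "continuous_on {a..b} y" for y
      unfolding A_def by (intro continuous_intros continuous_V cd that)
    define it where "it = (\<lambda>j. (A ^^ j) (\<lambda>_. z0))"
    have it: "continuous_on {a..b} (it j)" for j
      by (induction j) (auto simp: it_def cA)
    have itS: "it (Suc j) = A (it j)" for j by (simp add: it_def)
    \<comment> \<open>A point at distance \<open>d\<close> from \<open>\<tau>0\<close> consults the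
      previous iterate only at distances up to \<open>max 0 (d - h n)\<close>, so each iteration
      settles one more layer of width \<open>h n\<close>.\<close>
    have stab: "\<forall>t\<in>{a..b}. \<bar>t - \<tau>0\<bar> \<le> real j * h n \<longrightarrow> it (Suc j) t = it j t" for j
    proof (induction j)
      case 0
      then show ?case by (auto simp: it_def A_def)
    next
      case (Suc j)
      show ?case
      proof (intro ballI impI)
        fix t assume t: "t \<in> {a..b}" and le: "\<bar>t - \<tau>0\<bar> \<le> real (Suc j) * h n"
        have eq: "G s (it (Suc j) (\<delta> n s)) = G s (it j (\<delta> n s))"
          if s: "s \<in> {a..b}" "\<bar>s - \<tau>0\<bar> \<le> \<bar>t - \<tau>0\<bar>" for s
        proof -
          have "\<bar>s - \<tau>0\<bar> - h n \<le> real j * h n" using le s by (simp add: algebra_simps)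
          then have "\<bar>\<delta> n s - \<tau>0\<bar> \<le> real j * h n"
            using \<delta>d(2)[of n s] h[of n] by (smt (verit) mult_nonneg_nonneg of_nat_0_le_iff)
          then show ?thesis using Suc.IH \<delta>ab[OF s(1)] by simp
        qed
        define I where "I = (\<lambda>y. V (\<lambda>s. y (\<delta> n s)) t - V (\<lambda>s. y (\<delta> n s)) \<tau>0)"
        have "I (it (Suc j)) = I (it j)"
        proof (cases "\<tau>0 \<le> t")
          case True
          have "integral {\<tau>0..t} (\<lambda>s. G s (it (Suc j) (\<delta> n s))) = integral {\<tau>0..t} (\<lambda>s. G s (it j (\<delta> n s)))"
            by (rule integral_cong, rule eq) (use t \<tau>0 in auto)
          then show ?thesis unfolding I_def using V_diff[OF cd[OF it], of \<tau>0 t] True t \<tau>0 by simp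
        next
          case False
          have "integral {t..\<tau>0} (\<lambda>s. G s (it (Suc j) (\<delta> n s))) = integral {t..\<tau>0} (\<lambda>s. G s (it j (\<delta> n s)))"
            by (rule integral_cong, rule eq) (use t \<tau>0 in auto)
          then have "- I (it (Suc j)) = - I (it j)"
            unfolding I_def using V_diff[OF cd[OF it], of t \<tau>0] False t \<tau>0 by simp
          then show ?thesis by simp
        qed
        then show "it (Suc (Suc j)) t = it (Suc j) t"
          unfolding itS[of "Suc j"] itS[of j] A_def I_def by (simp add: itS A_def algebra_simps)
      qed
    qed
    obtain j :: nat where j: "(b - a) / h n < real j" using reals_Archimedean2 by blast
    then have "b - a < real j * h n" using h[of n] by (simp add: divide_less_eq)
    then have "it (Suc j) t = it j t" if "t \<in> {a..b}" for t
      using stab[of j] that \<tau>0 by auto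
    then have "\<forall>t\<in>{a..b}. it j t = z0 + V (\<lambda>s. it j (\<delta> n s)) t - V (\<lambda>s. it j (\<delta> n s)) \<tau>0"
      unfolding itS by (simp add: A_def)
    then show ?thesis using it by blast
  qed
  then obtain y where "\<And>n. continuous_on {a..b} (y n)"
    "\<And>n t. t \<in> {a..b} \<Longrightarrow> y n t = z0 + V (\<lambda>s. y n (\<delta> n s)) t - V (\<lambda>s. y n (\<delta> n s)) \<tau>0"
    by metis
  from delayed_solutions_compact[OF this(1) \<delta>c \<delta>ab \<delta>lim _ tendsto_const tendsto_const this(2)] \<tau>0
  show thesis using that by metis
qed

lemma integral_solution_iff:
  assumes \<tau>0: "\<tau>0 \<in> {a..b}"
  shows "integral_solution G a b w \<and> w \<tau>0 = z0 \<longleftrightarrow>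
    continuous_on {a..b} w \<and> (\<forall>t\<in>{a..b}. w t = z0 + V w t - V w \<tau>0)"
proof (intro iffI conjI ballI)
  assume L: "integral_solution G a b w \<and> w \<tau>0 = z0"
  then show "continuous_on {a..b} w" by (auto intro: integral_solution_continuous)
  fix t assume t: "t \<in> {a..b}"
  have "V w t = w t - w a" "V w \<tau>0 = w \<tau>0 - w a"
    using L t \<tau>0 unfolding V_def integral_solution_def by (meson integral_unique)+
  then show "w t = z0 + V w t - V w \<tau>0" using L by simp
next
  assume R: "continuous_on {a..b} w \<and> (\<forall>t\<in>{a..b}. w t = z0 + V w t - V w \<tau>0)"
  then have c: "continuous_on {a..b} w" by simp
  show "w \<tau>0 = z0" using R \<tau>0 by simp
  show "integral_solution G a b w"
    unfolding integral_solution_def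
  proof
    fix t assume t: "t \<in> {a..b}"
    have "w t - w a = V w t" using R t by (auto simp: V_def)
    moreover have "(\<lambda>s. G s (w s)) integrable_on {a..t}" using integrable_G[OF c] t by auto
    ultimately show "((\<lambda>s. G s (w s)) has_integral (w t - w a)) {a..t}"
      by (simp add: V_def integrable_integral)
  qed
qed

end

subsection \<open>Continuous dependence\<close>

text \<open>A continuation argument for truncated systems, which agree with the original one only
  while the bound by \<open>R\<close> holds. At the point \<open>q\<close> of \<open>A\<close>
  nearest to \<open>\<tau>\<close> the non-strict bound follows by continuity, and
  \<open>step\<close> turns it into a strict one, against \<open>f q \<ge> R\<close>.\<close>

lemma continuous_on_stays_below:
  fixes f :: "real \<Rightarrow> real"
  assumes f: "continuous_on {c..d} f" and \<tau>: "\<tau> \<in> {c..d}"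
    and step: "\<And>u v. c \<le> u \<Longrightarrow> u \<le> \<tau> \<Longrightarrow> \<tau> \<le> v \<Longrightarrow> v \<le> d \<Longrightarrow> (\<And>s. s \<in> {u..v} \<Longrightarrow> f s \<le> R) \<Longrightarrow>
      (\<And>s. s \<in> {u..v} \<Longrightarrow> f s < R)"
    and start: "f \<tau> < R" and s: "s \<in> {c..d}"
  shows "f s < R"
proof (rule ccontr)
  assume "\<not> f s < R"
  define A where "A = {t \<in> {c..d}. f t \<in> {R..}}"
  have "closed A" unfolding A_def by (rule continuous_closed_preimage[OF f, unfolded vimage_def Int_def mem_Collect_eq]) auto
  moreover have "bounded A" by (rule bounded_subset[of "{c..d}"]) (auto simp: A_def)
  ultimately have "compact A" by (simp add: compact_eq_bounded_closed)
  moreover have "A \<noteq> {}" using s \<open>\<not> f s < R\<close> by (auto simp: A_def)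
  ultimately obtain q where q: "q \<in> A" "\<And>t. t \<in> A \<Longrightarrow> dist \<tau> q \<le> dist \<tau> t"
    using distance_attains_inf[of A \<tau>] by (auto simp: compact_imp_closed)
  have qcd: "q \<in> {c..d}" and fq: "f q \<ge> R" using q(1) by (auto simp: A_def)
  define u v where "u = min q \<tau>" and "v = max q \<tau>"
  have below: "f t < R" if t: "t \<in> {u..v}" "t \<noteq> q" for t
  proof (rule ccontr)
    assume "\<not> f t < R"
    then have "t \<in> A" using t qcd \<tau> by (auto simp: A_def u_def v_def min_def max_def split: if_splits)
    then show False using q(2)[of t] t start fq by (auto simp: u_def v_def dist_real_def min_def max_def split: if_splits)
  qed
  have "q \<noteq> \<tau>" using start fq by auto
  then have uv: "u < v" "u \<le> q" "q \<le> v" "q = u \<or> q = v"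
    by (auto simp: u_def v_def min_def max_def)
  have "f q \<le> R"
  proof (rule continuous_le_on_closure[of "{u..v} - {q}" f q R])
    have cl: "closure ({u..v} - {q}) \<subseteq> {u..v}"
      by (rule closure_minimal) auto
    have "{u..v} \<subseteq> {c..d}" using qcd \<tau> by (auto simp: u_def v_def)
    then show "continuous_on (closure ({u..v} - {q})) f" using cl f continuous_on_subset by blast
    have "{u<..<v} \<subseteq> {u..v} - {q}" using uv by auto
    then have "closure {u<..<v} \<subseteq> closure ({u..v} - {q})" by (rule closure_mono)
    then show "q \<in> closure ({u..v} - {q})" using uv by auto
    show "f t \<le> R" if "t \<in> {u..v} - {q}" for t using below[of t] that by auto
  qed
  then have "f t \<le> R" if "t \<in> {u..v}" for t using below[of t] that by (cases "t = q") auto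
  then have "f q < R" using step[of u v q] qcd \<tau> uv by (auto simp: u_def v_def)
  then show False using fq by simp
qed

locale unique_system =
  fixes F :: "real \<Rightarrow> real^2 \<Rightarrow> real^2"
  assumes F: "caratheodory F" and uniq: "unique_solutions F"
begin

lemma integral_solution_unique:
  assumes "integral_solution F a b x" "integral_solution F a b y" "\<tau> \<in> {a..b}" "x \<tau> = y \<tau>" "t \<in> {a..b}"
  shows "x t = y t"
proof -
  have "cauchy_solution F \<tau> (y \<tau>) {a..b} x" "cauchy_solution F \<tau> (y \<tau>) {a..b} y"
    using assms integral_solution_imp_solution_on[OF F] by (auto simp: cauchy_solution_def)
  then show ?thesis using uniq assms(5) unfolding unique_solutions_def by blast
qed

text \<open>The nearest-point projection onto the ball of radius \<open>R\<close> is continuous and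
  fixes the ball. Composing with it turns the majorant for this one compact set into a bound for
  every state; exceptional times are absorbed by setting \<open>G\<close> to
  \<open>0\<close>.\<close>

lemma truncation:
  assumes "a \<le> b" "R > 0"
  obtains G m N where "bounded_system G m a b" "negligible N"
    "\<And>t z. t \<in> {a..b} - N \<Longrightarrow> norm z \<le> R \<Longrightarrow> G t z = F t z"
proof -
  obtain N1 where N1: "negligible N1" "\<And>t. t \<notin> N1 \<Longrightarrow> continuous_on UNIV (F t)"
    using F unfolding caratheodory_def eventually_ae_filter_negligible by blast
  obtain m :: "real \<Rightarrow> real" and N2 where m: "m absolutely_integrable_on {a..b}" "negligible N2"
    "\<And>t z. t \<in> {a..b} - N2 \<Longrightarrow> z \<in> cball 0 R \<Longrightarrow> norm (F t z) \<le> m t"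
    using caratheodory_bound[OF F compact_cball] by metis
  define N where "N = N1 \<union> N2"
  define P where "P = closest_point (cball (0::real^2) R)"
  have N: "negligible N" using N1 m by (simp add: N_def)
  have P: "P z \<in> cball 0 R" for z
    unfolding P_def using assms(2) by (intro closest_point_in_set) auto
  have contP: "continuous_on UNIV P"
    unfolding P_def using assms(2) by (intro continuous_on_closest_point) auto
  define G where "G = (\<lambda>t z. if t \<in> N \<union> - {a..b} then 0 else F t (P z))"
  \<comment> \<open>On the null set, where \<open>G\<close> is \<open>0\<close>, the majorant
    \<open>m\<close> may be negative.\<close>
  have "bounded_system G (\<lambda>t. \<bar>m t\<bar>) a b"
  proof
    have "N \<union> - {a..b} \<in> sets lebesgue" using negligible_imp_sets[OF N] by auto
    then show "(\<lambda>t. G t z) \<in> borel_measurable lebesgue" for z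
      unfolding G_def using F by (intro measurable_If_set) (auto simp: caratheodory_def)
    show "continuous_on UNIV (G t)" for t
    proof (cases "t \<in> N \<union> - {a..b}")
      case False
      then have "continuous_on UNIV (F t)" using N1(2) by (auto simp: N_def)
      then have "continuous_on UNIV (\<lambda>z. F t (P z))"
        using continuous_on_compose2[OF _ contP] by blast
      then show ?thesis using False by (simp add: G_def)
    qed (simp add: G_def)
    show "(\<lambda>t. \<bar>m t\<bar>) integrable_on {a..b}" using m(1) by (auto simp: absolutely_integrable_on_def)
    show "norm (G t z) \<le> \<bar>m t\<bar>" if "t \<in> {a..b}" for t z
      using m(3)[of t "P z"] P[of z] that by (auto simp: G_def N_def)
  qed (rule assms(1))
  moreover have "G t z = F t z" if "t \<in> {a..b} - N" "norm z \<le> R" for t z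
    using that closest_point_self[of z "cball 0 R"] by (simp add: G_def P_def)
  ultimately show thesis using N that by blast
qed

text \<open>While \<open>y\<close> stays in the closed ball it solves both systems, so by uniqueness
  it equals \<open>x\<close> and is strictly inside; it therefore never reaches the sphere.\<close>

lemma
  assumes N: "negligible N" and GF: "\<And>t z. t \<in> {a..b} - N \<Longrightarrow> norm z \<le> R \<Longrightarrow> G t z = F t z"
    and cd: "a \<le> c" "d \<le> b"
  shows truncated_solution_iff: "(\<And>t. t \<in> {c..d} \<Longrightarrow> norm (x t) \<le> R) \<Longrightarrow>
      integral_solution G c d x \<longleftrightarrow> integral_solution F c d x"
    and truncated_solution_eq: "\<lbrakk>integral_solution F c d x; integral_solution G a b y; \<tau> \<in> {c..d}; y \<tau> = x \<tau>;
      \<And>t. t \<in> {c..d} \<Longrightarrow> norm (x t) < R; t \<in> {c..d}\<rbrakk> \<Longrightarrow> y t = x t"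
proof -
  have iff: "integral_solution G c d x \<longleftrightarrow> integral_solution F c d x"
    if "\<And>t. t \<in> {c..d} \<Longrightarrow> norm (x t) \<le> R" "a \<le> c" "d \<le> b" for x c d
  proof -
    have "((\<lambda>s. G s (x s)) has_integral I) {c..t} \<longleftrightarrow> ((\<lambda>s. F s (x s)) has_integral I) {c..t}"
      if "t \<in> {c..d}" for t I
      by (rule has_integral_spike_eq[OF N])
        (use GF that \<open>a \<le> c\<close> \<open>d \<le> b\<close> \<open>\<And>t. t \<in> {c..d} \<Longrightarrow> norm (x t) \<le> R\<close> in auto)
    then show ?thesis by (auto simp: integral_solution_def)
  qed
  then show "integral_solution G c d x \<longleftrightarrow> integral_solution F c d x"
    if "\<And>t. t \<in> {c..d} \<Longrightarrow> norm (x t) \<le> R" using that cd by blast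
  assume x: "integral_solution F c d x" and y: "integral_solution G a b y" and \<tau>: "\<tau> \<in> {c..d}"
    and eq: "y \<tau> = x \<tau>" and xR: "\<And>t. t \<in> {c..d} \<Longrightarrow> norm (x t) < R" and t: "t \<in> {c..d}"
  have yc: "continuous_on {c..d} (\<lambda>t. norm (y t))"
    using continuous_on_subset[OF integral_solution_continuous[OF y], of "{c..d}"] cd
    by (intro continuous_intros) auto
  have step: "y s = x s" if uv: "c \<le> u" "u \<le> \<tau>" "\<tau> \<le> v" "v \<le> d" "\<And>s. s \<in> {u..v} \<Longrightarrow> norm (y s) \<le> R"
    and s: "s \<in> {u..v}" for u v s
  proof -
    have "integral_solution F u v y"
      using iff[of u v y] uv(5) integral_solution_subinterval[OF y, of u v] uv cd by simp
    moreover have "integral_solution F u v x" using integral_solution_subinterval[OF x] uv by auto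
    ultimately show ?thesis using integral_solution_unique eq s uv by (meson atLeastAtMost_iff)
  qed
  have yR: "norm (y s) < R" if "s \<in> {c..d}" for s
  proof (rule continuous_on_stays_below[OF yc \<tau> _ _ that])
    show "norm (y \<tau>) < R" using xR[OF \<tau>] eq by simp
    fix u v s assume "c \<le> u" "u \<le> \<tau>" "\<tau> \<le> v" "v \<le> d" "\<And>s. s \<in> {u..v} \<Longrightarrow> norm (y s) \<le> R" "s \<in> {u..v}"
    then show "norm (y s) < R" using step[of u v s] xR[of s] by auto
  qed
  show "y t = x t" using step[of c d t] \<tau> t yR by (auto intro: less_imp_le)
qed

text \<open>If the truncated solutions did not converge to \<open>x\<close>, a subsequence would
  stay away from \<open>x\<close>, a further one would converge to a solution with the same data,
  and uniqueness would make that solution \<open>x\<close>. The initial times vary with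
  \<open>k\<close> because solutions approach the origin at different times.\<close>

lemma continuous_dependence:
  assumes x: "integral_solution F a b x" and \<tau>: "\<And>k. \<tau> k \<in> {a..b}" "\<tau> \<longlonglongrightarrow> \<tau>0"
    and z: "z \<longlonglongrightarrow> x \<tau>0"
  obtains y where "uniform_limit {a..b} y x sequentially"
    "\<forall>\<^sub>F k in sequentially. integral_solution F a b (y k) \<and> y k (\<tau> k) = z k"
proof -
  have ab: "a \<le> b" using \<tau>(1)[of 0] by auto
  have \<tau>0: "\<tau>0 \<in> {a..b}"
    using closed_sequentially[OF closed_atLeastAtMost _ \<tau>(2)] \<tau>(1) by blast
  have "bounded (x ` {a..b})"
    using integral_solution_continuous[OF x] by (intro compact_imp_bounded compact_continuous_image) auto
  then obtain C where C: "\<And>t. t \<in> {a..b} \<Longrightarrow> norm (x t) \<le> C" "C > 0"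
    unfolding bounded_pos by (metis image_eqI)
  \<comment> \<open>The margin \<open>1\<close> keeps each \<open>y k\<close> at distance less than
    \<open>1\<close> from \<open>x\<close> in the ball where \<open>G\<close> and \<open>F\<close>
    agree.\<close>
  define R where "R = C + 1"
  have R: "R > 0" "norm (x t) < R" if "t \<in> {a..b}" for t using C(1)[OF that] C(2) by (simp_all add: R_def)
  have "R > 0" using C by (simp add: R_def)
  obtain G m N where G: "bounded_system G m a b" and N: "negligible N"
    and GF: "\<And>t z. t \<in> {a..b} - N \<Longrightarrow> norm z \<le> R \<Longrightarrow> G t z = F t z"
    using truncation[OF ab \<open>R > 0\<close>] by blast
  interpret bounded_system G m a b by (rule G)
  have "\<exists>w. continuous_on {a..b} w \<and> (\<forall>t\<in>{a..b}. w t = z k + V w t - V w (\<tau> k))" for k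
    using solution_exists[OF \<tau>(1)] by metis
  then obtain y where y: "\<And>k. continuous_on {a..b} (y k)"
    "\<And>k t. t \<in> {a..b} \<Longrightarrow> y k t = z k + V (y k) t - V (y k) (\<tau> k)" by metis
  have yG: "integral_solution G a b (y k)" "y k (\<tau> k) = z k" for k
    using integral_solution_iff[OF \<tau>(1)] y by blast+
  have ul: "uniform_limit {a..b} y x sequentially"
  proof (rule ccontr)
    assume "\<not> uniform_limit {a..b} y x sequentially"
    then obtain e where e: "e > 0" "\<And>K. \<exists>k\<ge>K. \<exists>t\<in>{a..b}. \<not> dist (y k t) (x t) < e"
      unfolding uniform_limit_iff eventually_sequentially by blast
    define B where "B = {k. \<exists>t\<in>{a..b}. \<not> dist (y k t) (x t) < e}"
    have "infinite B" unfolding infinite_nat_iff_unbounded_le B_def using e(2) by blast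
    then obtain q :: "nat \<Rightarrow> nat" where q: "strict_mono q" "\<And>k. q k \<in> B"
      using infinite_enumerate by blast
    have "(\<lambda>k. \<tau> (q k)) \<longlonglongrightarrow> \<tau>0" "(\<lambda>k. z (q k)) \<longlonglongrightarrow> x \<tau>0"
      using LIMSEQ_subseq_LIMSEQ[OF _ q(1)] \<tau>(2) z by (auto simp: o_def)
    then obtain r w where r: "strict_mono (r :: nat \<Rightarrow> nat)" and w: "continuous_on {a..b} w"
      and wl: "uniform_limit {a..b} (\<lambda>k. y (q (r k))) w sequentially"
      and weq: "\<And>t. t \<in> {a..b} \<Longrightarrow> w t = x \<tau>0 + V w t - V w \<tau>0"
      using delayed_solutions_compact[of "\<lambda>k. y (q k)" "\<lambda>k s. s" "\<lambda>k. \<tau> (q k)" \<tau>0 "\<lambda>k. z (q k)" "x \<tau>0"]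
        y \<tau>(1) by (metis continuous_on_id tendsto_const)
    have "integral_solution G a b w" "w \<tau>0 = x \<tau>0"
      using integral_solution_iff[OF \<tau>0] w weq by blast+
    then have "w t = x t" if "t \<in> {a..b}" for t
      using truncated_solution_eq[OF N GF order_refl order_refl x _ \<tau>0 _ R(2) that] by blast
    then have "uniform_limit {a..b} (\<lambda>k. y (q (r k))) x sequentially"
      using wl uniform_limit_cong'[of "{a..b}" "\<lambda>k. y (q (r k))" "\<lambda>k. y (q (r k))" w x] by blast
    then have "\<forall>\<^sub>F k in sequentially. \<forall>t\<in>{a..b}. dist (y (q (r k)) t) (x t) < e"
      using e(1) by (simp add: uniform_limit_iff)
    then obtain k where "\<forall>t\<in>{a..b}. dist (y (q (r k)) t) (x t) < e"
      by (auto simp: eventually_sequentially)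
    then show False using q(2)[of "r k"] by (auto simp: B_def)
  qed
  have "\<forall>\<^sub>F k in sequentially. integral_solution F a b (y k) \<and> y k (\<tau> k) = z k"
    using uniform_limitD[OF ul zero_less_one]
  proof eventually_elim
    case (elim k)
    have "norm (y k t) \<le> R" if "t \<in> {a..b}" for t
    proof -
      have "norm (y k t) \<le> norm (x t) + dist (y k t) (x t)"
        using norm_triangle_sub[of "y k t" "x t"] by (simp add: dist_norm)
      then show ?thesis using elim C(1)[OF that] that by (fastforce simp: R_def)
    qed
    then show ?case
      using truncated_solution_iff[OF N GF order_refl order_refl] yG by blast
  qed
  with ul show thesis by (rule that)
qed

end

subsection \<open>Blow-up and solutions meeting the origin\<close>

lemma is_interval_Icc_subset:
  fixes I :: "real set"
  assumes "is_interval I" "a \<in> I" "b \<in> I"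
  shows "{a..b} \<subseteq> I"
  using assms by (meson atLeastAtMost_iff is_interval_1 subsetI)

context unique_system
begin

lemma mem_existence_interval_iff:
  assumes "0 \<le> c"
  shows "c \<in> existence_interval F 0 z0 \<longleftrightarrow> (\<exists>x. integral_solution F 0 c x \<and> x 0 = z0)"
proof
  assume "c \<in> existence_interval F 0 z0"
  then obtain I x where I: "c \<in> I" "cauchy_solution F 0 z0 I x" by (auto simp: existence_interval_def)
  then have "solution_on F I x" "x 0 = z0" "0 \<in> I" "is_interval I" by (auto simp: cauchy_solution_def solution_on_def)
  moreover from this have "{0..c} \<subseteq> I" using I(1) is_interval_Icc_subset by blast
  ultimately show "\<exists>x. integral_solution F 0 c x \<and> x 0 = z0"
    using solution_on_imp_integral_solution by blast
next
  assume "\<exists>x. integral_solution F 0 c x \<and> x 0 = z0"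
  then obtain x where "integral_solution F 0 c x" "x 0 = z0" by blast
  then have "cauchy_solution F 0 z0 {0..c} x"
    using assms integral_solution_imp_solution_on[OF F] by (auto simp: cauchy_solution_def)
  then show "c \<in> existence_interval F 0 z0"
    using assms unfolding existence_interval_def by (intro UnionI[of "{0..c}"]) auto
qed

lemma phi_eq:
  assumes "integral_solution F 0 c x" "t \<in> {0..c}"
  shows "\<phi> F t (x 0) = x t"
  unfolding \<phi>_def
proof (rule zeta_eq[OF uniq])
  show "cauchy_solution F 0 (x 0) {0..c} x"
    using assms integral_solution_imp_solution_on[OF F] by (auto simp: cauchy_solution_def)
qed (rule assms(2))

lemma phi_solution:
  assumes "0 \<le> c" "c \<in> existence_interval F 0 z0"
  shows "integral_solution F 0 c (\<lambda>t. \<phi> F t z0)"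
proof -
  obtain x where "integral_solution F 0 c x" "x 0 = z0"
    using assms mem_existence_interval_iff by blast
  then show ?thesis using phi_eq by (auto intro: integral_solution_cong)
qed

lemma zero_mem_existence_interval: "0 \<in> existence_interval F 0 z0"
  unfolding mem_existence_interval_iff[OF order_refl]
  by (rule exI[of _ "\<lambda>_. z0"]) (simp add: integral_solution_def has_integral_refl)

lemma phi_0: "\<phi> F 0 z0 = z0"
proof -
  obtain x where "integral_solution F 0 0 x" "x 0 = z0"
    using zero_mem_existence_interval mem_existence_interval_iff by blast
  then show ?thesis using phi_eq[of 0 x 0] by simp
qed

lemma existence_interval_downward:
  assumes "c \<in> existence_interval F 0 z0" "0 \<le> d" "d \<le> c"
  shows "d \<in> existence_interval F 0 z0"
proof -
  obtain x where "integral_solution F 0 c x" "x 0 = z0"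
    using assms mem_existence_interval_iff[of c z0] by auto
  then show ?thesis using assms integral_solution_subinterval[of F 0 c x 0 d] mem_existence_interval_iff[of d z0] by auto
qed

lemma phi_continuous:
  assumes "0 \<le> c" "c \<in> existence_interval F 0 z0"
  shows "continuous_on {0..c} (\<lambda>t. \<phi> F t z0)"
  using phi_solution[OF assms] by (rule integral_solution_continuous)

lemma phi_continuous_dependence:
  assumes c: "0 \<le> c" "c \<in> existence_interval F 0 z0" and z: "z \<longlonglongrightarrow> z0"
  shows "\<forall>\<^sub>F k in sequentially. c \<in> existence_interval F 0 (z k)"
    "uniform_limit {0..c} (\<lambda>k t. \<phi> F t (z k)) (\<lambda>t. \<phi> F t z0) sequentially"
proof -
  obtain y where y: "uniform_limit {0..c} y (\<lambda>t. \<phi> F t z0) sequentially"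
    "\<forall>\<^sub>F k in sequentially. integral_solution F 0 c (y k) \<and> y k 0 = z k"
    using continuous_dependence[OF phi_solution[OF c], of "\<lambda>_. 0" 0 z] z c(1) phi_0 by auto
  show "\<forall>\<^sub>F k in sequentially. c \<in> existence_interval F 0 (z k)"
    using y(2) by eventually_elim (use c(1) mem_existence_interval_iff in blast)
  have "\<forall>\<^sub>F k in sequentially. \<forall>t\<in>{0..c}. y k t = \<phi> F t (z k)"
    using y(2) by eventually_elim (metis phi_eq)
  from uniform_limit_cong[OF this refl] y(1)
  show "uniform_limit {0..c} (\<lambda>k t. \<phi> F t (z k)) (\<lambda>t. \<phi> F t z0) sequentially" by blast
qed

text \<open>The truncated solution exists up to \<open>b\<close>, coincides with the given one on
  \<open>{0..c}\<close> and, its norm at \<open>c\<close> being less than \<open>R\<close>, stays in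
  the ball a little longer; that long it solves the original system.\<close>

lemma solution_extends:
  assumes c: "0 \<le> c" "c < b" "c \<in> existence_interval F 0 z0"
  obtains d where "c < d" "d \<le> b" "d \<in> existence_interval F 0 z0"
proof -
  define x where "x = (\<lambda>t. \<phi> F t z0)"
  have x: "integral_solution F 0 c x" "x 0 = z0"
    using phi_solution[OF c(1,3)] phi_0 by (auto simp: x_def)
  have "bounded (x ` {0..c})"
    using integral_solution_continuous[OF x(1)] by (intro compact_imp_bounded compact_continuous_image) auto
  then obtain C where C: "\<And>t. t \<in> {0..c} \<Longrightarrow> norm (x t) \<le> C" "C > 0"
    unfolding bounded_pos by (metis image_eqI)
  define R where "R = C + 1"
  have "R > 0" using C(2) by (simp add: R_def)
  have xR: "norm (x t) < R" if "t \<in> {0..c}" for t using C(1)[OF that] by (simp add: R_def)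
  have b: "0 \<le> b" "0 \<in> {0..b}" using c by auto
  obtain G m N where G: "bounded_system G m 0 b" and N: "negligible N"
    and GF: "\<And>t z. t \<in> {0..b} - N \<Longrightarrow> norm z \<le> R \<Longrightarrow> G t z = F t z"
    using truncation[OF b(1) \<open>R > 0\<close>] by blast
  interpret bounded_system G m 0 b by (rule G)
  obtain y where y: "integral_solution G 0 b y" "y 0 = z0"
    using solution_exists[OF b(2)] integral_solution_iff[OF b(2)] by metis
  have yx: "y t = x t" if "t \<in> {0..c}" for t
    by (rule truncated_solution_eq[OF N GF _ _ x(1) y(1), where \<tau>=0]) (use c x y xR that in auto)
  have yc: "continuous_on {0..b} (\<lambda>t. norm (y t))"
    using integral_solution_continuous[OF y(1)] by (intro continuous_intros)
  have "norm (y c) < R" using yx[of c] xR[of c] c by simp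
  then obtain e where e: "e > 0" "\<And>t. t \<in> {0..b} \<Longrightarrow> dist t c < e \<Longrightarrow> dist (norm (y t)) (norm (y c)) < R - norm (y c)"
    using yc c unfolding continuous_on_iff by (metis atLeastAtMost_iff diff_gt_0_iff_gt less_imp_le)
  define d where "d = min b (c + e/2)"
  have d: "c < d" "d \<le> b" "d < c + e" using c(2) e(1) by (auto simp: d_def min_def)
  have "norm (y t) \<le> R" if t: "t \<in> {0..d}" for t
  proof (cases "t \<le> c")
    case True then show ?thesis using yx[of t] xR[of t] t by simp
  next
    case False
    then have "dist (norm (y t)) (norm (y c)) < R - norm (y c)"
      using e(2)[of t] t d by (auto simp: dist_real_def)
    then show ?thesis by (auto simp: dist_real_def)
  qed
  then have "integral_solution F 0 d y"
    using truncated_solution_iff[OF N GF order_refl d(2), where x=y] integral_solution_subinterval[OF y(1) order_refl d(2)] by auto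
  then have "d \<in> existence_interval F 0 z0"
    using y(2) mem_existence_interval_iff[of d z0] d(1) c(1) by auto
  then show thesis using d that by blast
qed

text \<open>The solution truncated at \<open>C + 1\<close> lives on the closed interval and
  coincides with the given one before \<open>b\<close>; by continuity it obeys the bound
  \<open>C\<close> at \<open>b\<close> as well, so it solves the original system up to
  \<open>b\<close>.\<close>

lemma bounded_solution_extends:
  assumes b: "0 < b" and ex: "{0..<b} \<subseteq> existence_interval F 0 z0"
    and bnd: "\<And>t. t \<in> {0..<b} \<Longrightarrow> norm (\<phi> F t z0) \<le> C"
  shows "b \<in> existence_interval F 0 z0"
proof -
  define R where "R = C + 1"
  have "0 \<le> C" using bnd[of 0] b norm_ge_zero order_trans by (metis atLeastLessThan_iff order_refl)
  then have "R > 0" by (simp add: R_def)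
  have b': "0 \<le> b" "0 \<in> {0..b}" using b by auto
  obtain G m N where G: "bounded_system G m 0 b" and N: "negligible N"
    and GF: "\<And>t z. t \<in> {0..b} - N \<Longrightarrow> norm z \<le> R \<Longrightarrow> G t z = F t z"
    using truncation[OF b'(1) \<open>R > 0\<close>] by blast
  interpret bounded_system G m 0 b by (rule G)
  obtain y where y: "integral_solution G 0 b y" "y 0 = z0"
    using solution_exists[OF b'(2)] integral_solution_iff[OF b'(2)] by metis
  have yx: "y t = \<phi> F t z0" if t: "t \<in> {0..<b}" for t
  proof -
    have p: "integral_solution F 0 t (\<lambda>t. \<phi> F t z0)" using phi_solution t ex by auto
    have "norm (\<phi> F s z0) < R" if "s \<in> {0..t}" for s
      using bnd[of s] that t by (simp add: R_def)
    then show ?thesis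
      using truncated_solution_eq[OF N GF _ _ p y(1), where \<tau>=0] t y phi_0 by simp
  qed
  have "norm (y t) \<le> C" if t: "t \<in> {0..b}" for t
  proof (rule continuous_le_on_closure[of "{0..<b}" "\<lambda>t. norm (y t)" t C])
    have "closure {0..<b} = {0..b}" using b by simp
    then show "t \<in> closure {0..<b}" "continuous_on (closure {0..<b}) (\<lambda>t. norm (y t))"
      using t integral_solution_continuous[OF y(1)] by (auto intro: continuous_intros)
    show "norm (y s) \<le> C" if "s \<in> {0..<b}" for s using yx bnd that by simp
  qed
  then have "integral_solution F 0 b y"
    using truncated_solution_iff[OF N GF order_refl order_refl, where x=y] y(1) by (force simp: R_def)
  then show ?thesis
    using y(2) mem_existence_interval_iff[of b z0] b by auto
qed

text \<open>The forward part \<open>S\<close> of the existence interval is closed downwards and has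
  no greatest element, so it is \<open>{0..<TF}\<close>; a bound on it would allow continuation to
  \<open>TF\<close>. Later a single time of large norm is all that is extracted.\<close>

lemma blow_up:
  assumes T: "0 < T" "T \<notin> existence_interval F 0 z0"
  obtains TF where "0 < TF" "TF \<le> T" "blows_up_at F z0 TF" "\<And>C. \<exists>t\<in>{0..<TF}. norm (\<phi> F t z0) > C"
proof -
  define E where "E = existence_interval F 0 z0"
  define S where "S = E \<inter> {0..}"
  define TF where "TF = Sup S"
  have less: "s < T" if "s \<in> S" for s
  proof (rule ccontr)
    assume "\<not> s < T"
    then show False
      using that existence_interval_downward[of s z0 T] T by (simp add: S_def E_def)
  qed
  have bdd: "bdd_above S" using less by (meson bdd_aboveI less_imp_le)
  have ext: "\<exists>d\<in>S. c < d" if c: "c \<in> S" for c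
  proof -
    have c': "0 \<le> c" "c \<in> existence_interval F 0 z0" using c by (auto simp: S_def E_def)
    obtain d where "c < d" "d \<in> existence_interval F 0 z0"
      using solution_extends[OF c'(1) less[OF c] c'(2)] .
    then show ?thesis using c'(1) by (intro bexI[of _ d]) (auto simp: S_def E_def)
  qed
  have ne: "0 \<in> S" using zero_mem_existence_interval by (simp add: S_def E_def)
  have lt: "s < TF" if s: "s \<in> S" for s
  proof -
    obtain d where "d \<in> S" "s < d" using ext[OF s] by blast
    then show ?thesis using cSup_upper[OF _ bdd, of d] by (simp add: TF_def)
  qed
  have "0 < TF" using lt[OF ne] .
  moreover have "TF \<le> T" unfolding TF_def using ne less by (intro cSup_least) (auto intro: less_imp_le)
  moreover have S: "S = {0..<TF}"
  proof
    show "S \<subseteq> {0..<TF}" using lt by (auto simp: S_def)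
    show "{0..<TF} \<subseteq> S"
    proof
      fix t assume t: "t \<in> {0..<TF}"
      then obtain s where "s \<in> S" "t < s" using less_cSupD[of S t] ne by (auto simp: TF_def)
      then show "t \<in> S" using t existence_interval_downward[of s z0 t] by (auto simp: S_def E_def)
    qed
  qed
  moreover have "\<exists>t\<in>{0..<TF}. norm (\<phi> F t z0) > C" for C
  proof (rule ccontr)
    assume "\<not> (\<exists>t\<in>{0..<TF}. norm (\<phi> F t z0) > C)"
    then have "TF \<in> existence_interval F 0 z0"
      using S \<open>0 < TF\<close> by (intro bounded_solution_extends[of TF z0 C]) (auto simp: S_def E_def not_less)
    then have "TF \<in> S" using \<open>0 < TF\<close> by (simp add: S_def E_def)
    then show False using lt by blast
  qed
  ultimately show thesis using that by (simp add: blows_up_at_def S_def E_def)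
qed

end

section \<open>Solutions through and near the origin\<close>

locale global_zero_system = unique_system +
  fixes T :: real
  assumes T: "0 < T"
    and zero: "\<And>t0. t0 \<in> {0..T} \<Longrightarrow> {0..T} \<subseteq> existence_interval F t0 0"
begin

text \<open>\<open>existence_interval\<close> is a union of domains, so \<open>0\<close> and
  \<open>T\<close> may be reached by solutions with different domains; these are glued at
  \<open>t0\<close>.\<close>

lemma solution_through_zero:
  assumes t0: "t0 \<in> {0..T}"
  obtains x where "integral_solution F 0 T x" "x t0 = 0"
proof -
  have "0 \<in> existence_interval F t0 0" "T \<in> existence_interval F t0 0"
    using zero[OF t0] T by auto
  then obtain I1 I2 x1 x2 where 1: "0 \<in> I1" "cauchy_solution F t0 0 I1 x1" and 2: "T \<in> I2" "cauchy_solution F t0 0 I2 x2"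
    unfolding existence_interval_def by blast
  have "{0..t0} \<subseteq> I1" using 1 is_interval_Icc_subset unfolding cauchy_solution_def solution_on_def by blast
  then have s1: "integral_solution F 0 t0 x1"
    using 1 solution_on_imp_integral_solution by (auto simp: cauchy_solution_def)
  have "{t0..T} \<subseteq> I2" using 2 is_interval_Icc_subset unfolding cauchy_solution_def solution_on_def by blast
  then have s2: "integral_solution F t0 T x2"
    using 2 solution_on_imp_integral_solution by (auto simp: cauchy_solution_def)
  have x12: "x1 t0 = 0" "x2 t0 = 0" using 1 2 by (auto simp: cauchy_solution_def)
  define x where "x = (\<lambda>t. if t \<le> t0 then x1 t else x2 t)"
  have "integral_solution F 0 t0 x" by (rule integral_solution_cong[OF s1]) (simp add: x_def)
  moreover have "integral_solution F t0 T x"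
    by (rule integral_solution_cong[OF s2]) (use x12 in \<open>auto simp: x_def\<close>)
  ultimately have "integral_solution F 0 T x"
    by (rule integral_solution_combine) (use t0 in auto)
  moreover have "x t0 = 0" using x12 by (simp add: x_def)
  ultimately show thesis by (rule that)
qed

text \<open>The times \<open>t k\<close> accumulate at some \<open>t0\<close>, the solution through
  the origin at \<open>t0\<close> is global, and continuous dependence with initial times
  \<open>t (r k)\<close> transfers global existence to its neighbours.\<close>

lemma phi_limit_near_zero:
  assumes t: "\<And>k. 0 \<le> t k" "\<And>k. t k \<le> T" "\<And>k. t k \<in> existence_interval F 0 (z k)"
    and lim: "(\<lambda>k. \<phi> F (t k) (z k)) \<longlonglongrightarrow> 0"
  obtains r x t0 where "strict_mono r" "integral_solution F 0 T x" "t0 \<in> {0..T}" "x t0 = 0"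
    "\<forall>\<^sub>F k in sequentially. T \<in> existence_interval F 0 (z (r k))"
    "uniform_limit {0..T} (\<lambda>k s. \<phi> F s (z (r k))) x sequentially"
proof -
  obtain t0 r where r: "t0 \<in> {0..T}" "strict_mono (r::nat\<Rightarrow>nat)" "(\<lambda>k. t (r k)) \<longlonglongrightarrow> t0"
    using compact_Icc[of 0 T] t unfolding compact_def o_def by (metis atLeastAtMost_iff)
  obtain x where x: "integral_solution F 0 T x" "x t0 = 0" using solution_through_zero[OF r(1)] by blast
  have lim': "(\<lambda>k. \<phi> F (t (r k)) (z (r k))) \<longlonglongrightarrow> x t0"
    using LIMSEQ_subseq_LIMSEQ[OF lim r(2)] x(2) by (simp add: o_def)
  obtain y where y: "uniform_limit {0..T} y x sequentially"
    "\<forall>\<^sub>F k in sequentially. integral_solution F 0 T (y k) \<and> y k (t (r k)) = \<phi> F (t (r k)) (z (r k))"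
    by (rule continuous_dependence[OF x(1) _ r(3) lim']) (use t in auto)
  \<comment> \<open>\<open>y k\<close> is prescribed only at time \<open>t (r k)\<close>; uniqueness
    followed backwards shows that it starts at \<open>z (r k)\<close>.\<close>
  have ev: "\<forall>\<^sub>F k in sequentially. integral_solution F 0 T (y k) \<and> y k 0 = z (r k)"
    using y(2)
  proof eventually_elim
    case (elim k)
    have "integral_solution F 0 (t (r k)) (\<lambda>s. \<phi> F s (z (r k)))"
      using phi_solution t by blast
    moreover have "integral_solution F 0 (t (r k)) (y k)"
      using integral_solution_subinterval[of F 0 T "y k" 0 "t (r k)"] elim t by auto
    ultimately have "y k 0 = \<phi> F 0 (z (r k))"
      using integral_solution_unique[of 0 "t (r k)" _ "y k" "t (r k)" 0] elim t(1)[of "r k"] by fastforce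
    then show ?case using elim phi_0 by simp
  qed
  have "\<forall>\<^sub>F k in sequentially. T \<in> existence_interval F 0 (z (r k))"
    using ev by eventually_elim (use T mem_existence_interval_iff[of T] in auto)
  moreover have eq: "\<forall>\<^sub>F k in sequentially. \<forall>s\<in>{0..T}. y k s = \<phi> F s (z (r k))"
    using ev by eventually_elim (metis phi_eq)
  have "uniform_limit {0..T} (\<lambda>k s. \<phi> F s (z (r k))) x sequentially"
    using uniform_limit_cong[OF eq refl] y(1) by blast
  ultimately show thesis using that r x by blast
qed

text \<open>By contradiction, with \<open>r = 1/(k+1)\<close> and \<open>C = k\<close>. The main use
  is contrapositive: a solution whose norm exceeds \<open>C\<close> at some time in
  \<open>{0..T}\<close> keeps distance \<open>r\<close> from the origin.\<close>

lemma solutions_near_zero_bounded: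
  obtains r C where "r > 0" "\<And>z t. 0 \<le> t \<Longrightarrow> t \<le> T \<Longrightarrow> t \<in> existence_interval F 0 z \<Longrightarrow> norm (\<phi> F t z) < r \<Longrightarrow>
    T \<in> existence_interval F 0 z \<and> (\<forall>s\<in>{0..T}. norm (\<phi> F s z) \<le> C)"
proof (rule ccontr)
  assume "\<not> thesis"
  then have "\<forall>r>0. \<forall>C. \<exists>z t. 0 \<le> t \<and> t \<le> T \<and> t \<in> existence_interval F 0 z \<and> norm (\<phi> F t z) < r \<and>
    \<not> (T \<in> existence_interval F 0 z \<and> (\<forall>s\<in>{0..T}. norm (\<phi> F s z) \<le> C))"
    using that by meson
  then have "\<forall>k::nat. \<exists>z t. 0 \<le> t \<and> t \<le> T \<and> t \<in> existence_interval F 0 z \<and> norm (\<phi> F t z) < inverse (real (Suc k)) \<and>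
    \<not> (T \<in> existence_interval F 0 z \<and> (\<forall>s\<in>{0..T}. norm (\<phi> F s z) \<le> real k))"
    by (metis inverse_positive_iff_positive of_nat_0_less_iff zero_less_Suc)
  then obtain z t where zt: "\<And>k::nat. 0 \<le> t k" "\<And>k. t k \<le> T" "\<And>k. t k \<in> existence_interval F 0 (z k)"
    "\<And>k. norm (\<phi> F (t k) (z k)) < inverse (real (Suc k))"
    "\<And>k. \<not> (T \<in> existence_interval F 0 (z k) \<and> (\<forall>s\<in>{0..T}. norm (\<phi> F s (z k)) \<le> real k))"
    by metis
  have lim0: "(\<lambda>k. \<phi> F (t k) (z k)) \<longlonglongrightarrow> 0"
    by (rule Lim_null_comparison[OF _ LIMSEQ_inverse_real_of_nat]) (intro always_eventually allI less_imp_le zt(4))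
  obtain r x t0 where r: "strict_mono (r::nat\<Rightarrow>nat)" and x: "integral_solution F 0 T x"
    and ev: "\<forall>\<^sub>F k in sequentially. T \<in> existence_interval F 0 (z (r k))"
    and ul: "uniform_limit {0..T} (\<lambda>k s. \<phi> F s (z (r k))) x sequentially"
    by (rule phi_limit_near_zero[OF zt(1-3) lim0]) auto
  have "bounded (x ` {0..T})"
    using integral_solution_continuous[OF x] by (intro compact_imp_bounded compact_continuous_image) auto
  then obtain C where C: "\<And>s. s \<in> {0..T} \<Longrightarrow> norm (x s) \<le> C" "C > 0"
    unfolding bounded_pos by (metis image_eqI)
  obtain K :: nat where K: "C + 1 \<le> real K" using real_arch_simple by blast
  have "\<forall>\<^sub>F k in sequentially. False"
    using ev uniform_limitD[OF ul zero_less_one] eventually_ge_at_top[of K]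
  proof eventually_elim
    case (elim k)
    have "norm (\<phi> F s (z (r k))) \<le> real (r k)" if s: "s \<in> {0..T}" for s
    proof -
      have "norm (\<phi> F s (z (r k))) \<le> norm (x s) + dist (\<phi> F s (z (r k))) (x s)"
        using norm_triangle_sub[of "\<phi> F s (z (r k))" "x s"] by (simp add: dist_norm)
      also have "\<dots> \<le> C + 1" using elim(2) s C(1)[OF s] by (meson add_mono less_imp_le)
      also have "\<dots> \<le> real (r k)" using K elim(3) strict_mono_imp_increasing[OF r, of k] by linarith
      finally show ?thesis .
    qed
    then show False using zt(5)[of "r k"] elim(1) by blast
  qed
  then show False by simp
qed

text \<open>The set \<open>U\<close> of the overview.\<close>

definition global_set :: "(real^2) set" where
  "global_set = {z. T \<in> existence_interval F 0 z}"

lemma vanishing_set_global: "vanishing_set F T \<subseteq> global_set"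
proof
  obtain r C where "r > 0" "\<And>z t. 0 \<le> t \<Longrightarrow> t \<le> T \<Longrightarrow> t \<in> existence_interval F 0 z \<Longrightarrow> norm (\<phi> F t z) < r \<Longrightarrow>
    T \<in> existence_interval F 0 z \<and> (\<forall>s\<in>{0..T}. norm (\<phi> F s z) \<le> C)"
    using solutions_near_zero_bounded by blast
  moreover fix z assume "z \<in> vanishing_set F T"
  ultimately show "z \<in> global_set" unfolding vanishing_set_def global_set_def by force
qed

text \<open>Boundedness is the uniform bound read at time \<open>0\<close>, where the solution is
  \<open>z\<close> itself. For closedness, the zeros at times \<open>t k\<close> accumulate at a
  zero of the limit solution.\<close>

lemma compact_vanishing_set: "compact (vanishing_set F T)"
proof -
  obtain r C where rC: "r > 0" "\<And>z t. 0 \<le> t \<Longrightarrow> t \<le> T \<Longrightarrow> t \<in> existence_interval F 0 z \<Longrightarrow> norm (\<phi> F t z) < r \<Longrightarrow>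
    T \<in> existence_interval F 0 z \<and> (\<forall>s\<in>{0..T}. norm (\<phi> F s z) \<le> C)"
    using solutions_near_zero_bounded by blast
  have "norm z \<le> C" if z: "z \<in> vanishing_set F T" for z
  proof -
    obtain t where "0 \<le> t" "t \<le> T" "t \<in> existence_interval F 0 z" "norm (\<phi> F t z) < r"
      using z rC(1) by (auto simp: vanishing_set_def)
    then have "norm (\<phi> F 0 z) \<le> C" using rC(2) T by force
    then show ?thesis by (simp add: phi_0)
  qed
  then have "bounded (vanishing_set F T)" unfolding bounded_iff by blast
  moreover have "closed (vanishing_set F T)"
    unfolding closed_sequential_limits
  proof (intro allI impI)
    fix z z0 assume a: "(\<forall>k. z k \<in> vanishing_set F T) \<and> z \<longlonglongrightarrow> z0"
    then obtain t where t: "\<And>k. 0 \<le> t k" "\<And>k. t k \<le> T" "\<And>k. t k \<in> existence_interval F 0 (z k)"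
      "\<And>k. \<phi> F (t k) (z k) = 0"
      unfolding vanishing_set_def mem_Collect_eq Bex_def atLeastAtMost_iff by metis
    have lim0: "(\<lambda>k. \<phi> F (t k) (z k)) \<longlonglongrightarrow> 0" by (simp add: t(4))
    obtain r x t0 where r: "strict_mono (r::nat\<Rightarrow>nat)" and x: "integral_solution F 0 T x" "t0 \<in> {0..T}" "x t0 = 0"
      and ul: "uniform_limit {0..T} (\<lambda>k s. \<phi> F s (z (r k))) x sequentially"
      by (rule phi_limit_near_zero[OF t(1-3) lim0]) auto
    have "(\<lambda>k. \<phi> F 0 (z (r k))) \<longlonglongrightarrow> x 0" using tendsto_uniform_limitI[OF ul] T by auto
    moreover have "(\<lambda>k. z (r k)) \<longlonglongrightarrow> z0" using LIMSEQ_subseq_LIMSEQ[OF _ r] a by (auto simp: o_def)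
    ultimately have "x 0 = z0" by (simp add: phi_0 LIMSEQ_unique)
    then have "T \<in> existence_interval F 0 z0" "\<phi> F t0 z0 = 0"
      using x T mem_existence_interval_iff[of T z0] phi_eq[of T x t0] by auto
    then show "z0 \<in> vanishing_set F T"
      using x(2) existence_interval_downward[of T z0 t0] by (auto simp: vanishing_set_def)
  qed
  ultimately show ?thesis by (simp add: compact_eq_bounded_closed)
qed

lemma open_global_set: "open global_set"
proof -
  have "closed (- global_set)"
    unfolding closed_sequential_limits
  proof (intro allI impI)
    fix z z0 assume a: "(\<forall>k. z k \<in> - global_set) \<and> z \<longlonglongrightarrow> z0"
    show "z0 \<in> - global_set"
    proof
      assume "z0 \<in> global_set"
      then have "\<forall>\<^sub>F k in sequentially. z k \<in> global_set"
        using phi_continuous_dependence(1)[of T z0 z] T a by (auto simp: global_set_def)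
      then show False using a by (auto simp: eventually_sequentially)
    qed
  qed
  then show ?thesis by (simp add: open_closed)
qed

lemma phi_T_continuous: "continuous_on global_set (\<phi> F T)"
  unfolding continuous_on_sequentially
proof (intro allI ballI impI)
  fix z z0 assume a: "z0 \<in> global_set" "(\<forall>n. z n \<in> global_set) \<and> z \<longlonglongrightarrow> z0"
  then show "(\<phi> F T \<circ> z) \<longlonglongrightarrow> \<phi> F T z0"
    using tendsto_uniform_limitI[OF phi_continuous_dependence(2)[of T z0 z], of T] T
    by (auto simp: global_set_def o_def)
qed

end

subsection \<open>Rotation\<close>

definition to_complex :: "real^2 \<Rightarrow> complex" where
  "to_complex v = Complex (v $ 1) (v $ 2)"

lemma bounded_linear_to_complex: "bounded_linear to_complex"
  by (rule linear_conv_bounded_linear[THEN iffD1]) (auto intro!: linearI simp: to_complex_def complex_eq_iff)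

lemma to_complex_eq_iff [simp]: "to_complex v = to_complex w \<longleftrightarrow> v = w"
  by (auto simp: to_complex_def vec_eq_iff forall_2)

lemma to_complex_0 [simp]: "to_complex v = 0 \<longleftrightarrow> v = 0"
  by (auto simp: to_complex_def vec_eq_iff forall_2 complex_eq_iff)

lemma to_complex_scaleR: "to_complex (c *\<^sub>R v) = of_real c * to_complex v"
  by (simp add: to_complex_def complex_eq_iff)

lemma inner_J: "f \<bullet> (J *v v) = f $ 1 * v $ 2 - f $ 2 * v $ 1"
  by (simp add: J_mult inner_vec_def sum_2)

lemma norm_J: "norm (J *v v) = norm v"
  by (simp add: J_mult norm_eq_sqrt_inner inner_vec_def sum_2 algebra_simps)

text \<open>\<open>J\<close> turns vectors clockwise by a right angle, whereas the argument grows
  counterclockwise; hence the minus sign. With \<open>f\<close> the velocity at \<open>v\<close>,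
  this is the rate of change of the argument.\<close>

lemma Im_to_complex_divide:
  "Im (to_complex f / to_complex v) = - (f \<bullet> (J *v v)) / (norm v)\<^sup>2"
proof -
  have "(norm v)\<^sup>2 = (v $ 1)\<^sup>2 + (v $ 2)\<^sup>2"
    unfolding power2_norm_eq_inner by (simp add: inner_vec_def sum_2 power2_eq_square)
  then show ?thesis
    by (simp add: Im_divide to_complex_def inner_J algebra_simps)
qed

lemma inner_J_divide_bound: "\<bar>f \<bullet> (J *v v) / (norm v)\<^sup>2\<bar> \<le> norm f / norm v"
proof (cases "v = 0")
  case False
  have "\<bar>f \<bullet> (J *v v)\<bar> \<le> norm f * norm v"
    using Cauchy_Schwarz_ineq2[of f "J *v v"] by (simp add: norm_J)
  then show ?thesis using False by (simp add: divide_simps power2_eq_square)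
qed simp

lemma exp_Lipschitz:
  assumes "norm (u::complex) \<le> B" "norm v \<le> B"
  shows "norm (exp u - exp v) \<le> exp B * norm (u - v)"
proof (rule field_differentiable_bound[where S="cball 0 B"])
  show "(exp has_field_derivative exp z) (at z within cball 0 B)" for z :: complex
    by (rule DERIV_subset[OF DERIV_exp]) simp
  show "norm (exp z) \<le> exp B" if "z \<in> cball 0 B" for z :: complex
    using that norm_exp[of z] by (auto intro: order_trans)
qed (use assms in auto)

context unique_system
begin

definition nonvanishing :: "real \<Rightarrow> real^2 \<Rightarrow> bool" where
  "nonvanishing c z \<longleftrightarrow> 0 \<le> c \<and> c \<in> existence_interval F 0 z \<and> (\<forall>t\<in>{0..c}. \<phi> F t z \<noteq> 0)"

definition angular_velocity :: "real^2 \<Rightarrow> real \<Rightarrow> real" where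
  "angular_velocity z s = (F s (\<phi> F s z) \<bullet> (J *v \<phi> F s z)) / (norm (\<phi> F s z))\<^sup>2"

lemma nonvanishing_downward:
  "nonvanishing c z \<Longrightarrow> 0 \<le> d \<Longrightarrow> d \<le> c \<Longrightarrow> nonvanishing d z"
  using existence_interval_downward by (auto simp: nonvanishing_def)

lemma polar_integrable:
  assumes z: "nonvanishing c z"
  shows "(\<lambda>s. to_complex (F s (\<phi> F s z)) / to_complex (\<phi> F s z)) absolutely_integrable_on {0..c}"
proof -
  have c: "0 \<le> c" "c \<in> existence_interval F 0 z" using z by (auto simp: nonvanishing_def)
  have cont: "continuous_on {0..c} (\<lambda>s. inverse (to_complex (\<phi> F s z)))"
    using z phi_continuous[OF c] bounded_linear.continuous_on[OF bounded_linear_to_complex]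
    by (intro continuous_on_inverse) (auto simp: nonvanishing_def)
  have f: "(\<lambda>s. to_complex (F s (\<phi> F s z))) absolutely_integrable_on {0..c}"
    using absolutely_integrable_linear[OF integral_solution_absolutely_integrable[OF F phi_solution[OF c] c(1)]
        bounded_linear_to_complex] by (simp add: o_def)
  have "(\<lambda>s. inverse (to_complex (\<phi> F s z)) * to_complex (F s (\<phi> F s z))) absolutely_integrable_on {0..c}"
  proof (rule absolutely_integrable_bounded_measurable_product[OF bilinear_times _ _ _ f])
    show "(\<lambda>s. inverse (to_complex (\<phi> F s z))) \<in> borel_measurable (lebesgue_on {0..c})"
      using cont by (intro continuous_imp_measurable_on_sets_lebesgue) auto
    show "bounded ((\<lambda>s. inverse (to_complex (\<phi> F s z))) ` {0..c})"
      using cont by (intro compact_imp_bounded compact_continuous_image) auto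
  qed auto
  then show ?thesis by (simp add: divide_inverse mult.commute)
qed

lemma angular_velocity_eq: "angular_velocity z s = - Im (to_complex (F s (\<phi> F s z)) / to_complex (\<phi> F s z))"
  unfolding angular_velocity_def Im_to_complex_divide by simp

lemma angular_velocity_integrable:
  assumes z: "nonvanishing c z"
  shows "angular_velocity z absolutely_integrable_on {0..c}"
proof -
  have "bounded_linear (\<lambda>x::complex. - Im x)" by (intro bounded_linear_minus bounded_linear_Im)
  from absolutely_integrable_linear[OF polar_integrable[OF z] this]
  show ?thesis by (simp add: o_def angular_velocity_eq[abs_def])
qed

lemma rot_eq:
  assumes z: "nonvanishing c z"
  shows "rot F c z = 1 / (2 * pi) * integral {0..c} (angular_velocity z)"
  using set_lebesgue_integral_eq_integral(2)[OF angular_velocity_integrable[OF z]]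
  by (simp add: rot_def angular_velocity_def[abs_def])

text \<open>In complex notation \<open>(log z)' = F / z\<close>, so that \<open>- 2 * pi * rot\<close> is the variation of the argument.\<close>

lemma polar_form:
  assumes z: "nonvanishing c z"
  obtains B where "to_complex (\<phi> F c z) = to_complex z * exp B" "Im B = - 2 * pi * rot F c z"
proof -
  have c: "0 \<le> c" "c \<in> existence_interval F 0 z" and nz: "\<And>t. t \<in> {0..c} \<Longrightarrow> \<phi> F t z \<noteq> 0"
    using z by (auto simp: nonvanishing_def)
  define X where "X = (\<lambda>t. to_complex (\<phi> F t z))"
  define h where "h = (\<lambda>s. to_complex (F s (\<phi> F s z)) / to_complex (\<phi> F s z))"
  define \<beta> where "\<beta> = (\<lambda>t. integral {0..t} h)"
  \<comment> \<open>\<open>exp (- \<beta> t)\<close> is the integrating factor of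
    \<open>X' = h X\<close>. The derivative of \<open>W\<close> is seen to vanish only almost
    everywhere, so absolute continuity is what makes \<open>W\<close> constant.\<close>
  define W where "W = (\<lambda>t. X t * exp (- \<beta> t))"
  have h: "h absolutely_integrable_on {0..c}" unfolding h_def by (rule polar_integrable[OF z])
  have hi: "h integrable_on {0..c}" using set_lebesgue_integral_eq_integral(1)[OF h] .
  have sol: "solution_on F {0..c} (\<lambda>t. \<phi> F t z)"
    using phi_solution[OF c] by (rule integral_solution_imp_solution_on[OF F])
  have ac\<beta>: "absolutely_continuous_on {0..c} \<beta>"
    using absolutely_continuous_on_integral[OF h, of 0] by (simp add: \<beta>_def)
  have ac\<phi>: "absolutely_continuous_on {0..c} (\<lambda>t. \<phi> F t z)" using sol by (auto simp: solution_on_def)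
  obtain K where K: "K > 0" "\<And>v. norm (to_complex v) \<le> norm v * K"
    using bounded_linear.pos_bounded[OF bounded_linear_to_complex] by blast
  have Xdist: "norm (X u - X v) \<le> K * dist (\<phi> F u z) (\<phi> F v z)" for u v
    using K(2)[of "\<phi> F u z - \<phi> F v z"] linear_diff[OF bounded_linear.linear[OF bounded_linear_to_complex]]
    by (simp add: X_def dist_norm mult.commute)
  have "continuous_on {0..c} X" unfolding X_def
    using bounded_linear.continuous_on[OF bounded_linear_to_complex phi_continuous[OF c]] .
  then have "bounded (X ` {0..c})" by (intro compact_imp_bounded compact_continuous_image) auto
  then obtain B1 where B1: "B1 > 0" "\<And>t. t \<in> {0..c} \<Longrightarrow> norm (X t) \<le> B1"
    unfolding bounded_pos by (metis image_eqI)
  have "continuous_on {0..c} \<beta>" unfolding \<beta>_def using hi by (rule indefinite_integral_continuous_1)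
  then have "bounded (\<beta> ` {0..c})" by (intro compact_imp_bounded compact_continuous_image) auto
  then obtain B2 where B2: "B2 > 0" "\<And>t. t \<in> {0..c} \<Longrightarrow> norm (\<beta> t) \<le> B2"
    unfolding bounded_pos by (metis image_eqI)
  define C where "C = max (K * exp B2) (B1 * exp B2)"
  have acW: "absolutely_continuous_on {0..c} W"
  proof (rule absolutely_continuous_on_lipschitz2[OF ac\<phi> ac\<beta>])
    show "C > 0" using K(1) by (simp add: C_def less_max_iff_disj)
    fix u v assume uv: "u \<in> {0..c}" "v \<in> {0..c}"
    have e: "norm (exp (- \<beta> u)) \<le> exp B2" using norm_exp[of "- \<beta> u"] B2(2)[OF uv(1)] by (auto intro: order_trans)
    have "dist (W u) (W v) = norm ((X u - X v) * exp (- \<beta> u) + X v * (exp (- \<beta> u) - exp (- \<beta> v)))"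
      by (simp add: W_def dist_norm algebra_simps)
    also have "\<dots> \<le> norm (X u - X v) * norm (exp (- \<beta> u)) + norm (X v) * norm (exp (- \<beta> u) - exp (- \<beta> v))"
      by (metis norm_mult norm_triangle_ineq)
    also have "\<dots> \<le> (K * dist (\<phi> F u z) (\<phi> F v z)) * exp B2 + B1 * (exp B2 * norm (- \<beta> u - (- \<beta> v)))"
      using Xdist e B1 B2 uv K(1) by (intro add_mono mult_mono exp_Lipschitz) auto
    also have "\<dots> = (K * exp B2) * dist (\<phi> F u z) (\<phi> F v z) + (B1 * exp B2) * dist (\<beta> u) (\<beta> v)"
      by (simp add: dist_norm norm_minus_commute)
    also have "\<dots> \<le> C * dist (\<phi> F u z) (\<phi> F v z) + C * dist (\<beta> u) (\<beta> v)"
      by (intro add_mono mult_right_mono) (auto simp: C_def)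
    finally show "dist (W u) (W v) \<le> C * dist (\<phi> F u z) (\<phi> F v z) + C * dist (\<beta> u) (\<beta> v)" .
  qed
  obtain N1 where N1: "negligible N1"
    "\<And>t. t \<in> {0..c} - N1 \<Longrightarrow> ((\<lambda>t. \<phi> F t z) has_vector_derivative F t (\<phi> F t z)) (at t within {0..c})"
    using sol by (auto simp: solution_on_def AE_lebesgue_on_negligible)
  obtain N2 where N2: "negligible N2"
    "\<And>t. t \<in> {0..c} - N2 \<Longrightarrow> (\<beta> has_vector_derivative h t) (at t within {0..c})"
    unfolding \<beta>_def using integral_has_vector_derivative_AE[OF hi] by blast
  have "((\<lambda>_. 0) has_integral W c - W 0) {0..c}"
  proof (rule absolutely_continuous_on_FTC[OF c(1) acW])
    show "negligible (N1 \<union> N2)" using N1 N2 by simp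
    fix t assume t: "t \<in> {0..c} - (N1 \<union> N2)"
    have X': "(X has_vector_derivative to_complex (F t (\<phi> F t z))) (at t within {0..c})"
      unfolding X_def using t by (intro bounded_linear.has_vector_derivative[OF bounded_linear_to_complex] N1(2)) auto
    have \<beta>': "(\<beta> has_vector_derivative h t) (at t within {0..c})" using t N2(2) by auto
    have "((\<lambda>t. exp (- \<beta> t)) has_vector_derivative - h t * exp (- \<beta> t)) (at t within {0..c})"
      using field_vector_diff_chain_within[OF has_vector_derivative_minus[OF \<beta>'] DERIV_subset[OF DERIV_exp subset_UNIV]]
      by (simp add: o_def)
    from has_vector_derivative_mult[OF X' this]
    have "(W has_vector_derivative X t * (- h t * exp (- \<beta> t)) + to_complex (F t (\<phi> F t z)) * exp (- \<beta> t)) (at t within {0..c})"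
      by (simp add: W_def)
    moreover have "X t * h t = to_complex (F t (\<phi> F t z))" using nz[of t] t by (simp add: X_def h_def)
    ultimately show "(W has_vector_derivative 0) (at t within {0..c})"
      by (simp add: algebra_simps mult.assoc[symmetric])
  qed
  then have "W c = W 0" using has_integral_0_eq by force
  then have "X c * exp (- \<beta> c) = to_complex z" by (simp add: W_def \<beta>_def X_def phi_0)
  then have "to_complex (\<phi> F c z) = to_complex z * exp (\<beta> c)"
    by (metis X_def exp_minus_inverse mult.assoc mult.commute mult.right_neutral)
  moreover have "Im (\<beta> c) = - 2 * pi * rot F c z"
  proof -
    have "Im (\<beta> c) = integral {0..c} (\<lambda>s. Im (h s))"
      unfolding \<beta>_def using integral_linear[OF hi bounded_linear_Im] by (simp add: o_def)
    also have "\<dots> = - integral {0..c} (angular_velocity z)"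
      unfolding integral_neg[symmetric] by (simp add: angular_velocity_eq h_def)
    finally show ?thesis by (simp add: rot_eq[OF z])
  qed
  ultimately show thesis by (rule that)
qed

text \<open>The argument changes by an odd multiple of pi, so the complex factor
  \<open>exp B\<close> is a negative real number, of modulus \<open>exp (Re B)\<close>.\<close>

lemma half_turn:
  assumes z: "nonvanishing c z" and r: "rot F c z = real n + 1/2"
  obtains \<kappa> where "\<kappa> > 0" "\<phi> F c z = - \<kappa> *\<^sub>R z"
proof -
  obtain B where B: "to_complex (\<phi> F c z) = to_complex z * exp B" "Im B = - 2 * pi * rot F c z"
    using polar_form[OF z] .
  have "Im B = - pi + 2 * pi * (- real n)" using B(2) r by (simp add: algebra_simps)
  then have "cis (Im B) = cis (- pi) * cis (2 * pi * (- real n))" by (simp only: cis_mult)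
  also have "\<dots> = - 1" by (subst cis_multiple_2pi) (auto simp: complex_eq_iff)
  finally have "exp B = - of_real (exp (Re B))"
    using exp_eq_polar[of B] by simp
  then have "to_complex (\<phi> F c z) = to_complex (- exp (Re B) *\<^sub>R z)"
    using B(1) by (simp only: to_complex_scaleR) simp
  then show thesis using that[of "exp (Re B)"] by simp
qed

text \<open>Nearby solutions eventually lie in a fixed annulus, where the angular velocity is
  dominated by an integrable majorant of \<open>F\<close> divided by the inner radius; dominated
  convergence then applies.\<close>

lemma rot_continuous:
  assumes z0: "nonvanishing c z0" and z: "z \<longlonglongrightarrow> z0"
  shows "\<forall>\<^sub>F k in sequentially. nonvanishing c (z k)" "(\<lambda>k. rot F c (z k)) \<longlonglongrightarrow> rot F c z0"
proof -
  have c: "0 \<le> c" "c \<in> existence_interval F 0 z0" and nz: "\<And>t. t \<in> {0..c} \<Longrightarrow> \<phi> F t z0 \<noteq> 0"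
    using z0 by (auto simp: nonvanishing_def)
  note cd = phi_continuous_dependence[OF c z]
  have cont: "continuous_on {0..c} (\<lambda>t. norm (\<phi> F t z0))"
    using phi_continuous[OF c] by (intro continuous_intros)
  obtain p where p: "p \<in> {0..c}" "\<And>t. t \<in> {0..c} \<Longrightarrow> norm (\<phi> F p z0) \<le> norm (\<phi> F t z0)"
    using continuous_attains_inf[OF compact_Icc _ cont] c(1) by auto
  obtain q where "\<forall>t\<in>{0..c}. norm (\<phi> F t z0) \<le> norm (\<phi> F q z0)"
    using continuous_attains_sup[OF compact_Icc _ cont] c(1) by auto
  then have q: "\<And>t. t \<in> {0..c} \<Longrightarrow> norm (\<phi> F t z0) \<le> norm (\<phi> F q z0)" by blast
  \<comment> \<open>Half the minimal distance from the origin: a perturbation smaller than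
    \<open>\<rho>\<close> leaves a distance of at least \<open>\<rho>\<close>.\<close>
  define \<rho> where "\<rho> = norm (\<phi> F p z0) / 2"
  define C where "C = norm (\<phi> F q z0) + \<rho>"
  have \<rho>: "\<rho> > 0" using nz[OF p(1)] by (simp add: \<rho>_def)
  have ev: "\<forall>\<^sub>F k in sequentially. c \<in> existence_interval F 0 (z k) \<and>
      (\<forall>t\<in>{0..c}. norm (\<phi> F t (z k)) \<ge> \<rho> \<and> norm (\<phi> F t (z k)) \<le> C)"
    using cd(1) uniform_limitD[OF cd(2) \<rho>]
  proof eventually_elim
    case (elim k)
    have "norm (\<phi> F t (z k)) \<ge> \<rho> \<and> norm (\<phi> F t (z k)) \<le> C" if t: "t \<in> {0..c}" for t
    proof -
      have d: "norm (\<phi> F t (z k) - \<phi> F t z0) < \<rho>" using elim(2) t by (simp add: dist_norm)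
      show ?thesis
        using norm_triangle_ineq2[of "\<phi> F t z0" "\<phi> F t (z k)"] norm_triangle_ineq2[of "\<phi> F t (z k)" "\<phi> F t z0"]
          d p(2)[OF t] q[OF t] by (auto simp: \<rho>_def C_def norm_minus_commute)
    qed
    then show ?case using elim(1) by blast
  qed
  then show ev1: "\<forall>\<^sub>F k in sequentially. nonvanishing c (z k)"
    by eventually_elim (use \<rho> c(1) in \<open>force simp: nonvanishing_def\<close>)
  obtain K where K: "\<And>k. k \<ge> K \<Longrightarrow> nonvanishing c (z k)"
    "\<And>k t. k \<ge> K \<Longrightarrow> t \<in> {0..c} \<Longrightarrow> norm (\<phi> F t (z k)) \<ge> \<rho> \<and> norm (\<phi> F t (z k)) \<le> C"
    using eventually_conj[OF ev ev1] unfolding eventually_sequentially by blast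
  obtain m :: "real \<Rightarrow> real" and N1 where m: "m absolutely_integrable_on {0..c}" "negligible N1"
    "\<And>t v. t \<in> {0..c} - N1 \<Longrightarrow> v \<in> cball 0 C \<Longrightarrow> norm (F t v) \<le> m t"
    using caratheodory_bound[OF F compact_cball] by metis
  obtain N2 where N2: "negligible N2" "\<And>t. t \<notin> N2 \<Longrightarrow> continuous_on UNIV (F t)"
    using F unfolding caratheodory_def eventually_ae_filter_negligible by blast
  define N where "N = N1 \<union> N2"
  have N: "negligible N" using m(2) N2(1) by (simp add: N_def)
  \<comment> \<open>The majorant and the continuity of \<open>F s\<close> hold only off
    \<open>N\<close>, while dominated convergence is applied with conditions at every point;
    changing the integrand on \<open>N\<close> keeps its integral.\<close>
  define g where "g = (\<lambda>w s. if s \<in> N then 0 else angular_velocity w s)"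
  have gint: "integral {0..c} (g w) = integral {0..c} (angular_velocity w)" for w
    by (rule integral_spike[OF N]) (auto simp: g_def)
  have "(\<lambda>k. integral {0..c} (g (z (k + K)))) \<longlonglongrightarrow> integral {0..c} (g z0)"
  proof (rule dominated_convergence(2)[where h="\<lambda>s. \<bar>m s\<bar> / \<rho>"])
    show "g (z (k + K)) integrable_on {0..c}" for k
    proof (rule integrable_spike[OF _ N])
      show "angular_velocity (z (k + K)) integrable_on {0..c}"
        by (rule set_lebesgue_integral_eq_integral(1)[OF angular_velocity_integrable[OF K(1)]]) simp
    qed (simp add: g_def)
    show "(\<lambda>s. \<bar>m s\<bar> / \<rho>) integrable_on {0..c}"
      using m(1) by (intro integrable_on_divide) (auto simp: absolutely_integrable_on_def)
    show "norm (g (z (k + K)) s) \<le> \<bar>m s\<bar> / \<rho>" if s: "s \<in> {0..c}" for k s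
    proof (cases "s \<in> N")
      case False
      have b: "norm (\<phi> F s (z (k + K))) \<ge> \<rho>" "norm (\<phi> F s (z (k + K))) \<le> C" using K(2)[of "k+K" s] s by auto
      then have "norm (F s (\<phi> F s (z (k + K)))) \<le> \<bar>m s\<bar>"
        using m(3)[of s "\<phi> F s (z (k + K))"] False s by (auto simp: N_def)
      then have "norm (F s (\<phi> F s (z (k + K)))) / norm (\<phi> F s (z (k + K))) \<le> \<bar>m s\<bar> / \<rho>"
        using b \<rho> by (intro frac_le) auto
      then show ?thesis using False inner_J_divide_bound[of "F s (\<phi> F s (z (k + K)))" "\<phi> F s (z (k + K))"]
        by (simp add: g_def angular_velocity_def)
    qed (use \<rho> in \<open>simp add: g_def\<close>)
    show "(\<lambda>k. g (z (k + K)) s) \<longlonglongrightarrow> g z0 s" if s: "s \<in> {0..c}" for s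
    proof (cases "s \<in> N")
      case False
      have v: "(\<lambda>k. \<phi> F s (z (k + K))) \<longlonglongrightarrow> \<phi> F s z0"
        using LIMSEQ_ignore_initial_segment[OF tendsto_uniform_limitI[OF cd(2) s]] .
      have "isCont (F s) (\<phi> F s z0)"
        using N2(2)[of s] False by (auto simp: N_def continuous_on_eq_continuous_at)
      from isCont_tendsto_compose[OF this v]
      have f: "(\<lambda>k. F s (\<phi> F s (z (k + K)))) \<longlonglongrightarrow> F s (\<phi> F s z0)" .
      have "(\<lambda>k. J *v \<phi> F s (z (k + K))) \<longlonglongrightarrow> J *v \<phi> F s z0"
        by (intro bounded_linear.tendsto[OF matrix_vector_mul_bounded_linear] v)
      then have "(\<lambda>k. angular_velocity (z (k + K)) s) \<longlonglongrightarrow> angular_velocity z0 s"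
        unfolding angular_velocity_def using f v nz[OF s] by (intro tendsto_intros) auto
      then show ?thesis using False by (simp add: g_def)
    qed (simp add: g_def)
  qed
  then have "(\<lambda>k. rot F c (z (k + K))) \<longlonglongrightarrow> rot F c z0"
    using K(1) z0 by (simp add: gint rot_eq) (intro tendsto_intros; simp)
  then show "(\<lambda>k. rot F c (z k)) \<longlonglongrightarrow> rot F c z0" by (rule LIMSEQ_offset)
qed

end

subsection \<open>Periodic solutions\<close>

text \<open>The set \<open>A\<close> of solutions of \<open>z = s P z\<close> with \<open>s\<close>
  in \<open>[0, 1]\<close> avoids the frontier. A Urysohn function, \<open>1\<close> on
  \<open>A\<close> and \<open>0\<close> outside \<open>\<Omega>\<close>, cuts \<open>P\<close> off
  to a bounded continuous map of the whole space. Brouwer's theorem on a large ball gives a fixed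
  point of it, which lies in \<open>A\<close>, where \<open>P\<close> is unchanged.\<close>

lemma leray_schauder:
  fixes P :: "'a::euclidean_space \<Rightarrow> 'a"
  assumes \<Omega>: "open \<Omega>" "bounded \<Omega>" "0 \<in> \<Omega>" and P: "continuous_on (closure \<Omega>) P"
    and bd: "\<And>z \<mu>. z \<in> frontier \<Omega> \<Longrightarrow> \<mu> > 1 \<Longrightarrow> P z \<noteq> \<mu> *\<^sub>R z"
  obtains z where "z \<in> closure \<Omega>" "P z = z"
proof (cases "\<exists>z\<in>frontier \<Omega>. P z = z")
  case True
  then show thesis using that by (auto simp: frontier_def)
next
  case False
  define A where "A = {z \<in> closure \<Omega>. \<exists>s\<in>{0..1}. z = s *\<^sub>R P z}"
  have cl: "compact (closure \<Omega>)" using \<Omega>(2) by (simp add: compact_closure)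
  \<comment> \<open>\<open>A\<close> is the projection of a closed set of pairs
    \<open>(s, z)\<close> in \<open>D\<close>; compactness of \<open>D\<close> makes it
    closed.\<close>
  define D where "D = ({0..1::real} \<times> closure \<Omega>)"
  have D: "compact D" unfolding D_def by (intro compact_Times cl compact_Icc)
  have "continuous_on D (\<lambda>p. snd p - fst p *\<^sub>R P (snd p))"
    unfolding D_def by (intro continuous_intros continuous_on_compose2[OF P]) auto
  then have "closed {p \<in> D. snd p - fst p *\<^sub>R P (snd p) = 0}"
    using compact_imp_closed[OF D] by (rule continuous_closed_preimage_constant)
  then have "compact {p \<in> D. snd p - fst p *\<^sub>R P (snd p) = 0}"
    using bounded_subset[OF compact_imp_bounded[OF D]] by (simp add: compact_eq_bounded_closed)
  then have "compact (snd ` {p \<in> D. snd p - fst p *\<^sub>R P (snd p) = 0})"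
    by (intro compact_continuous_image continuous_intros)
  moreover have "snd ` {p \<in> D. snd p - fst p *\<^sub>R P (snd p) = 0} = A"
    by (force simp: A_def D_def image_iff)
  ultimately have A: "closed A" by (simp add: compact_imp_closed)
  have "z \<in> \<Omega>" if "z \<in> A" for z
  proof (rule ccontr)
    assume "z \<notin> \<Omega>"
    obtain s where z: "z \<in> closure \<Omega>" "s \<in> {0..1}" "z = s *\<^sub>R P z" using \<open>z \<in> A\<close> by (auto simp: A_def)
    have fr: "z \<in> frontier \<Omega>" using z(1) \<open>z \<notin> \<Omega>\<close> \<Omega>(1) by (simp add: frontier_def interior_open)
    have "s \<noteq> 0" using z \<Omega>(3) \<open>z \<notin> \<Omega>\<close> by auto
    moreover have "s \<noteq> 1" using z(3) fr False by auto
    ultimately have s: "0 < s" "s < 1" using z(2) by auto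
    have "(1/s) *\<^sub>R z = P z" using s z(3) by (metis divide_inverse less_irrefl mult_1 scaleR_one scaleR_scaleR left_inverse)
    then show False using bd[OF fr, of "1/s"] s by auto
  qed
  then have disj: "A \<inter> - \<Omega> = {}" by blast
  obtain \<mu> :: "'a \<Rightarrow> real" where \<mu>: "continuous_on UNIV \<mu>" "\<And>x. \<mu> x \<in> closed_segment 1 0"
    "\<And>x. x \<in> A \<Longrightarrow> \<mu> x = 1" "\<And>x. x \<in> - \<Omega> \<Longrightarrow> \<mu> x = 0"
    using Urysohn[OF A _ disj, of 1 0] \<Omega>(1) by auto
  have \<mu>01: "0 \<le> \<mu> x" "\<mu> x \<le> 1" for x
    using \<mu>(2)[of x] by (auto simp: closed_segment_eq_real_ivl)
  define G where "G = (\<lambda>z. if z \<in> closure \<Omega> then \<mu> z *\<^sub>R P z else 0)"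
  have "continuous_on (closure \<Omega> \<union> - \<Omega>) G"
    unfolding G_def
  proof (rule continuous_on_cases)
    show "continuous_on (closure \<Omega>) (\<lambda>z. \<mu> z *\<^sub>R P z)"
      using continuous_on_subset[OF \<mu>(1)] P by (intro continuous_intros) auto
  qed (use \<Omega>(1) \<mu>(4) in auto)
  moreover have "closure \<Omega> \<union> - \<Omega> = UNIV" using closure_subset by auto
  ultimately have contG: "continuous_on UNIV G" by simp
  have "bounded (P ` closure \<Omega>)" using cl P by (intro compact_imp_bounded compact_continuous_image)
  then obtain B where B: "B > 0" "\<And>z. z \<in> closure \<Omega> \<Longrightarrow> norm (P z) \<le> B"
    unfolding bounded_pos by (metis image_eqI)
  have "norm (G z) \<le> B" for z
  proof (cases "z \<in> closure \<Omega>")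
    case True
    have "\<mu> z * norm (P z) \<le> 1 * B" using \<mu>01[of z] B True by (intro mult_mono) auto
    then show ?thesis using \<mu>01[of z] True by (simp add: G_def)
  qed (use B in \<open>simp add: G_def\<close>)
  then have GB: "G \<in> cball 0 B \<rightarrow> cball 0 B" by simp
  obtain z where z: "G z = z"
    by (rule brouwer[OF compact_cball convex_cball _ continuous_on_subset[OF contG subset_UNIV] GB]) (use B(1) in auto)
  have zc: "z \<in> closure \<Omega>"
  proof (rule ccontr)
    assume n: "z \<notin> closure \<Omega>"
    then have "z = 0" using z by (simp add: G_def)
    then show False using n \<Omega>(3) closure_subset by blast
  qed
  then have "z = \<mu> z *\<^sub>R P z" using z by (simp add: G_def)
  then have "z \<in> A" using zc \<mu>01[of z] by (auto simp: A_def)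
  then have "P z = z" using \<mu>(3) \<open>z = \<mu> z *\<^sub>R P z\<close> by (metis scaleR_one)
  with zc show thesis by (rule that)
qed

section \<open>Extension of a solution on one period to the real line\<close>

lemma integral_solution_shift:
  assumes x: "integral_solution F a b x" and per: "\<And>t z. F (t + c) z = F t z"
  shows "integral_solution F (a + c) (b + c) (\<lambda>t. x (t - c))"
  unfolding integral_solution_def
proof
  fix t assume t: "t \<in> {a + c..b + c}"
  have "((\<lambda>s. F s (x s)) has_integral (x (t - c) - x a)) {a..t - c}"
    using x t by (auto simp: integral_solution_def)
  moreover have "(\<lambda>s. F s (x s)) = (\<lambda>s. F s (x (s - c))) \<circ> (+) c"
    using per by (simp add: fun_eq_iff add.commute)
  ultimately show "((\<lambda>s. F s (x (s - c))) has_integral (x (t - c) - x (a + c - c))) {a + c..t}"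
    using has_integral_shift_Icc_real[of "\<lambda>s. F s (x (s - c))" c "x (t - c) - x a" a "t - c"] by simp
qed

text \<open>Every time is interior to one of the growing intervals, so derivatives within an
  interval become full derivatives, and the countable union of exceptional sets is null.\<close>

lemma solution_on_UNIV:
  assumes F: "caratheodory F" and T: "T > 0"
    and x: "\<And>n::nat. integral_solution F (- (real n * T)) (real n * T) x"
  shows "solution_on F UNIV x"
proof -
  have sol: "solution_on F {- (real n * T)..real n * T} x" for n
    by (rule integral_solution_imp_solution_on[OF F x])
  have "\<exists>N. negligible N \<and> (\<forall>t\<in>{- (real n * T)..real n * T} - N.
      (x has_vector_derivative F t (x t)) (at t within {- (real n * T)..real n * T}))" for n
    using sol[of n] by (auto simp: solution_on_def AE_lebesgue_on_negligible)
  then obtain N where N: "\<And>n. negligible (N n)" "\<And>n t. t \<in> {- (real n * T)..real n * T} - N n \<Longrightarrow>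
      (x has_vector_derivative F t (x t)) (at t within {- (real n * T)..real n * T})" by metis
  have ex: "\<exists>n::nat. \<bar>t\<bar> < real n * T" for t
  proof -
    obtain n :: nat where "\<bar>t\<bar> / T < real n" using reals_Archimedean2 by blast
    then show ?thesis using T by (auto simp: divide_less_eq)
  qed
  have der: "(x has_vector_derivative F t (x t)) (at t)" if t: "t \<notin> \<Union>(range N)" for t
  proof -
    obtain n :: nat where n: "\<bar>t\<bar> < real n * T" using ex by blast
    have "(x has_vector_derivative F t (x t)) (at t within {- (real n * T)..real n * T})"
      using n t by (intro N(2)) auto
    moreover have "at t within {- (real n * T)..real n * T} = at t"
      using n by (intro at_within_interior) auto
    ultimately show ?thesis by simp
  qed
  have neg: "negligible (\<Union>(range N))" using N(1) by (intro negligible_countable_Union) auto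
  show ?thesis
    unfolding solution_on_def
  proof (intro conjI allI impI)
    fix a b :: real
    obtain n1 n2 :: nat where "\<bar>a\<bar> < real n1 * T" "\<bar>b\<bar> < real n2 * T" using ex by meson
    moreover have "real n1 * T \<le> real (max n1 n2) * T" "real n2 * T \<le> real (max n1 n2) * T"
      using T by (intro mult_right_mono; simp)+
    ultimately have "{a..b} \<subseteq> {- (real (max n1 n2) * T)..real (max n1 n2) * T}" by auto
    then show "absolutely_continuous_on {a..b} x" using sol by (auto simp: solution_on_def)
    show "AE t in lebesgue_on UNIV. (x has_vector_derivative F t (x t)) (at t)"
      using der neg by (subst AE_lebesgue_on_negligible) auto
  qed simp
qed

lemma periodic_extension:
  assumes F: "caratheodory F" and T: "T > 0" and per: "\<And>t z. F (t + T) z = F t z"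
    and x: "integral_solution F 0 T x" "x T = x 0"
  obtains y where "solution_on F UNIV y" "\<And>t. y (t + T) = y t"
proof -
  define y where "y = (\<lambda>t. x (t - of_int \<lfloor>t / T\<rfloor> * T))"
  have yT: "y (t + T) = y t" for t
  proof -
    have "(t + T) / T = t / T + 1" using T by (simp add: add_divide_distrib)
    then have "\<lfloor>(t + T) / T\<rfloor> = \<lfloor>t / T\<rfloor> + 1" by simp
    then show ?thesis by (simp add: y_def algebra_simps)
  qed
  have y0: "y t = x t" if "t \<in> {0..T}" for t
  proof (cases "t = T")
    \<comment> \<open>At \<open>t = T\<close> the floor is already \<open>1\<close>, so
      \<open>y T\<close> is \<open>x 0\<close>; here \<open>x T = x 0\<close> enters.\<close>
    case True then show ?thesis using T x(2) by (simp add: y_def)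
  next
    case False
    then have "\<lfloor>t / T\<rfloor> = 0" using that T by (intro floor_unique) (auto simp: divide_simps)
    then show ?thesis by (simp add: y_def)
  qed
  have perm: "F (t + - T) z = F t z" for t z using per[of "t - T" z] by simp
  have base: "integral_solution F 0 T y"
    using integral_solution_cong[OF x(1)] y0 by metis
  have ymT: "y (t - T) = y t" for t using yT[of "t - T"] by simp
  have fwd: "integral_solution F (a + T) (b + T) y" if "integral_solution F a b y" for a b
    using integral_solution_shift[OF that per] ymT by simp
  have bwd: "integral_solution F (a - T) (b - T) y" if "integral_solution F a b y" for a b
    using integral_solution_shift[OF that perm] yT by simp
  have up: "integral_solution F (real n * T) (real (Suc n) * T) y" for n
  proof (induction n)
    case (Suc n) from fwd[OF Suc] show ?case by (simp add: algebra_simps)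
  qed (use base in simp)
  have down: "integral_solution F (- (real (Suc n) * T)) (- (real n * T)) y" for n
  proof (induction n)
    case 0 from bwd[OF base] show ?case by simp
  next
    case (Suc n)
    have "- (real k * T) - T = - (real (Suc k) * T)" for k by (simp add: algebra_simps)
    then show ?case using bwd[OF Suc] by metis
  qed
  have "integral_solution F (- (real n * T)) (real n * T) y" for n
  proof (induction n)
    case 0
    then show ?case using integral_solution_subinterval[OF base, of 0 0] T by simp
  next
    case (Suc n)
    have le: "0 \<le> real n * T" "real n * T \<le> real (Suc n) * T" using T by (auto simp: algebra_simps)
    have "integral_solution F (- (real (Suc n) * T)) (real n * T) y"
      using le by (intro integral_solution_combine[OF down Suc]) auto
    then show ?case using le by (intro integral_solution_combine[OF _ up]) auto
  qed
  then have "solution_on F UNIV y" by (rule solution_on_UNIV[OF F T])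
  then show thesis using that yT by blast
qed

section \<open>Rotation near blow-up and the fixed point of the Poincare map\<close>

context global_zero_system
begin

lemma nonvanishing_T_iff: "nonvanishing T z \<longleftrightarrow> z \<in> global_set - vanishing_set F T"
  using T existence_interval_downward by (auto simp: nonvanishing_def global_set_def vanishing_set_def)

text \<open>Two times before the blow-up are chosen independently: at \<open>t\<close> the rotation
  of \<open>z0\<close> exceeds \<open>M\<close> plus the largest possible later loss, at
  \<open>u\<close> its norm exceeds \<open>C\<close>. Both pass to \<open>z k\<close> by continuous
  dependence, since the solution from \<open>z0\<close> still exists at these times.\<close>

lemma rot_at_boundary:
  assumes blow: "\<And>z0 TF. blows_up_at F z0 TF \<Longrightarrow> TF \<le> T \<Longrightarrow> filterlim (\<lambda>t. rot F t z0) at_top (at_left TF)"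
    and l: "R > 0" "AE t in lebesgue_on {0..T}. \<forall>z. norm z \<ge> R \<longrightarrow> F t z \<bullet> (J *v z) \<ge> l * (norm z)\<^sup>2"
    and z: "\<And>k. nonvanishing T (z k)" "z \<longlonglongrightarrow> z0" and z0: "z0 \<notin> global_set"
  shows "\<forall>\<^sub>F k in sequentially. rot F T (z k) > M"
proof -
  obtain r C where rC: "r > 0" "\<And>z t. 0 \<le> t \<Longrightarrow> t \<le> T \<Longrightarrow> t \<in> existence_interval F 0 z \<Longrightarrow> norm (\<phi> F t z) < r \<Longrightarrow>
    T \<in> existence_interval F 0 z \<and> (\<forall>s\<in>{0..T}. norm (\<phi> F s z) \<le> C)"
    using solutions_near_zero_bounded by blast
  obtain TF where TF: "0 < TF" "TF \<le> T" "blows_up_at F z0 TF" "\<And>C. \<exists>t\<in>{0..<TF}. norm (\<phi> F t z0) > C"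
    using blow_up[OF T, of z0] z0 by (auto simp: global_set_def)
  have inE: "t \<in> existence_interval F 0 z0" if "t \<in> {0..<TF}" for t
    using TF(3) that unfolding blows_up_at_def by blast
  \<comment> \<open>A zero before \<open>TF\<close> would put \<open>z0\<close> into the vanishing
    set and hence into \<open>global_set\<close>.\<close>
  have nv: "nonvanishing t z0" if "t \<in> {0..<TF}" for t
    using that inE TF(2) z0 vanishing_set_global by (fastforce simp: nonvanishing_def vanishing_set_def)
  obtain N1 where N1: "negligible N1" "\<And>t z. t \<in> {0..T} - N1 \<Longrightarrow> norm z \<ge> R \<Longrightarrow> F t z \<bullet> (J *v z) \<ge> l * (norm z)\<^sup>2"
    using l(2) by (auto simp: AE_lebesgue_on_negligible)
  obtain m :: "real \<Rightarrow> real" and N2 where m: "m absolutely_integrable_on {0..T}" "negligible N2"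
    "\<And>t v. t \<in> {0..T} - N2 \<Longrightarrow> v \<in> cball 0 R \<Longrightarrow> norm (F t v) \<le> m t"
    using caratheodory_bound[OF F compact_cball] by metis
  \<comment> \<open>At norms from \<open>R\<close> on the angular velocity is at least
    \<open>l\<close>; at smaller norms not below \<open>r\<close> it is at most
    \<open>\<bar>m s\<bar> / r\<close> in absolute value. The sum covers both cases.\<close>
  define q where "q = (\<lambda>s. \<bar>l\<bar> + \<bar>m s\<bar> / r)"
  have q: "q integrable_on {0..T}" unfolding q_def
    using m(1) by (intro integrable_add integrable_on_divide integrable_const_ivl) (auto simp: absolutely_integrable_on_def)
  have q0: "q s \<ge> 0" for s using rC(1) by (simp add: q_def)
  have lower: "angular_velocity w s \<ge> - q s" if s: "s \<in> {0..T} - (N1 \<union> N2)" and w: "norm (\<phi> F s w) \<ge> r" for w s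
  proof (cases "norm (\<phi> F s w) \<ge> R")
    case True
    have n0: "0 < (norm (\<phi> F s w))\<^sup>2" using w rC(1) by (intro zero_less_power) linarith
    have "l * (norm (\<phi> F s w))\<^sup>2 \<le> F s (\<phi> F s w) \<bullet> (J *v \<phi> F s w)"
      using N1(2)[of s "\<phi> F s w"] True s by auto
    then have "l \<le> angular_velocity w s" unfolding angular_velocity_def using n0 by (simp add: pos_le_divide_eq)
    moreover have "0 \<le> \<bar>m s\<bar> / r" using rC(1) by simp
    ultimately show ?thesis by (simp add: q_def)
  next
    case False
    then have "norm (F s (\<phi> F s w)) \<le> \<bar>m s\<bar>" using m(3)[of s "\<phi> F s w"] s by auto
    then have "norm (F s (\<phi> F s w)) / norm (\<phi> F s w) \<le> \<bar>m s\<bar> / r"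
      using w rC(1) by (intro frac_le) auto
    moreover have "\<bar>angular_velocity w s\<bar> \<le> norm (F s (\<phi> F s w)) / norm (\<phi> F s w)"
      unfolding angular_velocity_def by (rule inner_J_divide_bound)
    ultimately show ?thesis unfolding q_def by linarith
  qed
  have rot_lower: "rot F T w \<ge> rot F t w - 1 / (2 * pi) * integral {0..T} q"
    if w: "nonvanishing T w" "\<And>s. s \<in> {0..T} \<Longrightarrow> norm (\<phi> F s w) \<ge> r" and t: "t \<in> {0..T}" for w t
  proof -
    have ai: "angular_velocity w integrable_on {0..T}"
      using angular_velocity_integrable[OF w(1)] set_lebesgue_integral_eq_integral(1) by blast
    have sub: "{t..T} \<subseteq> {0..T}" using t by auto
    have qi: "q integrable_on {t..T}" and ati: "angular_velocity w integrable_on {t..T}"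
      using integrable_on_subinterval[OF q sub] integrable_on_subinterval[OF ai sub] by auto
    define q' where "q' = (\<lambda>s. if s \<in> N1 \<union> N2 then - angular_velocity w s else q s)"
    have Nn: "negligible (N1 \<union> N2)" using N1(1) m(2) by simp
    have q'i: "q' integrable_on {t..T}"
      by (rule integrable_spike[OF qi Nn]) (simp add: q'_def)
    have q'q: "integral {t..T} q' = integral {t..T} q"
      by (rule integral_spike[OF Nn]) (simp add: q'_def)
    have "integral {t..T} (\<lambda>s. - q' s) \<le> integral {t..T} (angular_velocity w)"
    proof (rule integral_le)
      show "- q' s \<le> angular_velocity w s" if "s \<in> {t..T}" for s
        using lower[of s w] w(2)[of s] that t by (auto simp: q'_def)
    qed (use q'i ati in \<open>auto intro: integrable_neg\<close>)
    moreover have "integral {t..T} q \<le> integral {0..T} q"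
      by (rule integral_subset_le[OF sub qi q]) (use q0 in auto)
    moreover have "integral {0..t} (angular_velocity w) + integral {t..T} (angular_velocity w) = integral {0..T} (angular_velocity w)"
      by (rule Henstock_Kurzweil_Integration.integral_combine) (use t ai in auto)
    ultimately have "integral {0..T} (angular_velocity w) \<ge> integral {0..t} (angular_velocity w) - integral {0..T} q"
      using q'q by (simp add: integral_neg)
    then have "1 / (2 * pi) * (integral {0..t} (angular_velocity w) - integral {0..T} q) \<le> 1 / (2 * pi) * integral {0..T} (angular_velocity w)"
      by (intro mult_left_mono) auto
    then show ?thesis
      using rot_eq[OF w(1)] rot_eq[OF nonvanishing_downward[OF w(1)], of t] t
      by (simp add: algebra_simps diff_divide_distrib)
  qed
  define Q where "Q = 1 / (2 * pi) * integral {0..T} q"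
  have "\<forall>\<^sub>F t in at_left TF. M + Q < rot F t z0"
    using blow[OF TF(3,2)] unfolding filterlim_at_top_dense by blast
  moreover have "\<forall>\<^sub>F t in at_left TF. t \<in> {0<..<TF}"
    using eventually_at_left_real[OF TF(1)] .
  ultimately have "\<exists>t. M + Q < rot F t z0 \<and> t \<in> {0<..<TF}"
    using eventually_happens'[OF trivial_limit_at_left_real eventually_conj] by blast
  then obtain t where t: "t \<in> {0..<TF}" "M + Q < rot F t z0"
    by (meson atLeastLessThan_iff greaterThanLessThan_iff less_imp_le)
  obtain u where u: "u \<in> {0..<TF}" "norm (\<phi> F u z0) > C" using TF(4) by blast
  have "(\<lambda>k. rot F t (z k)) \<longlonglongrightarrow> rot F t z0" by (rule rot_continuous(2)[OF nv[OF t(1)] z(2)])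
  then have ev1: "\<forall>\<^sub>F k in sequentially. M + Q < rot F t (z k)"
    using order_tendstoD(1) t(2) by blast
  have "(\<lambda>k. \<phi> F u (z k)) \<longlonglongrightarrow> \<phi> F u z0"
    using tendsto_uniform_limitI[OF phi_continuous_dependence(2)[OF _ inE[OF u(1)] z(2)], of u] u(1) by auto
  then have ev2: "\<forall>\<^sub>F k in sequentially. C < norm (\<phi> F u (z k))"
    using order_tendstoD(1)[OF tendsto_norm] u(2) by blast
  show ?thesis
    using ev1 ev2
  proof eventually_elim
    case (elim k)
    \<comment> \<open>Coming closer than \<open>r\<close> to the origin would bound the whole
      solution by \<open>C\<close>, against its size at time \<open>u\<close>.\<close>
    have "norm (\<phi> F s (z k)) \<ge> r" if s: "s \<in> {0..T}" for s
    proof (rule ccontr)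
      assume "\<not> norm (\<phi> F s (z k)) \<ge> r"
      moreover have "s \<in> existence_interval F 0 (z k)"
        using nonvanishing_downward[OF z(1), of s] s by (auto simp: nonvanishing_def)
      ultimately have "norm (\<phi> F u (z k)) \<le> C" using rC(2)[of s "z k"] s u(1) TF(2) by auto
      then show False using elim(2) by simp
    qed
    then have "rot F T (z k) \<ge> rot F t (z k) - Q"
      unfolding Q_def using rot_lower[OF z(1)] t(1) TF(2) by auto
    then show ?case using elim(1) by simp
  qed
qed

lemma fixed_point:
  assumes blow: "\<And>z0 TF. blows_up_at F z0 TF \<Longrightarrow> TF \<le> T \<Longrightarrow> filterlim (\<lambda>t. rot F t z0) at_top (at_left TF)"
    and l: "R > 0" "AE t in lebesgue_on {0..T}. \<forall>z. norm z \<ge> R \<longrightarrow> F t z \<bullet> (J *v z) \<ge> l * (norm z)\<^sup>2"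
    and large: "(generalized_rot F T \<longlongrightarrow> \<infinity>) (inf at_infinity (principal (- vanishing_set F T)))"
  obtains z where "z \<in> global_set" "\<phi> F T z = z"
proof -
  define \<N> where "\<N> = vanishing_set F T"
  obtain e where e: "e > 0" "(\<Union>z\<in>\<N>. ball z e) \<subseteq> global_set"
    using compact_subset_open_imp_ball_epsilon_subset[OF compact_vanishing_set open_global_set vanishing_set_global]
    unfolding \<N>_def by blast
  \<comment> \<open>The radius is halved so that the closure of \<open>W\<close> still lies in the
    balls of radius \<open>e\<close>.\<close>
  define W where "W = (\<Union>z\<in>\<N>. ball z (e/2))"
  have W: "open W" "\<N> \<subseteq> W" using e(1) by (auto simp: W_def)
  have Wcl: "closure W \<subseteq> global_set"
  proof
    fix z assume "z \<in> closure W"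
    then obtain w where w: "w \<in> W" "dist w z < e/2" using e(1) by (meson closure_approachable half_gt_zero)
    then obtain v where v: "v \<in> \<N>" "dist v w < e/2" by (auto simp: W_def)
    then have "z \<in> ball v e" using w(2) dist_triangle_half_l[of v w e z] by (simp add: dist_commute)
    then show "z \<in> global_set" using e(2) v(1) by blast
  qed
  have Wb: "bounded W"
  proof -
    obtain b where b: "\<And>v. v \<in> \<N> \<Longrightarrow> norm v \<le> b"
      using compact_imp_bounded[OF compact_vanishing_set] unfolding bounded_iff \<N>_def by blast
    have "norm w \<le> b + e" if w: "w \<in> W" for w
    proof -
      obtain v where v: "v \<in> \<N>" "dist v w < e/2" using w by (auto simp: W_def)
      then show ?thesis using b[OF v(1)] e(1) norm_triangle_sub[of w v] by (simp add: dist_norm norm_minus_commute)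
    qed
    then show ?thesis unfolding bounded_iff by blast
  qed
  have nonv: "nonvanishing T z \<longleftrightarrow> z \<in> global_set - \<N>" for z
    by (simp add: nonvanishing_T_iff \<N>_def)
  have rotc: "continuous_on (global_set - \<N>) (rot F T)"
    unfolding continuous_on_sequentially
  proof (intro allI ballI impI)
    fix z z0 assume a: "z0 \<in> global_set - \<N>" "(\<forall>n. z n \<in> global_set - \<N>) \<and> z \<longlonglongrightarrow> z0"
    then have "(\<lambda>k. rot F T (z k)) \<longlonglongrightarrow> rot F T z0"
      using nonv by (intro rot_continuous(2)) auto
    then show "(rot F T \<circ> z) \<longlonglongrightarrow> rot F T z0" by (simp add: o_def)
  qed
  have frW: "frontier W \<subseteq> global_set - \<N>"
    using W Wcl by (auto simp: frontier_def interior_open)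
  have "compact (frontier W)" using Wb by (simp add: compact_frontier_bounded)
  then have "bounded (rot F T ` frontier W)"
    using continuous_on_subset[OF rotc frW] by (intro compact_imp_bounded compact_continuous_image)
  then obtain b where b: "\<And>z. z \<in> frontier W \<Longrightarrow> \<bar>rot F T z\<bar> \<le> b" unfolding bounded_iff by auto
  obtain n :: nat where n: "b \<le> real n" using real_arch_simple by blast
  \<comment> \<open>The level exceeds the bound \<open>b\<close> on the frontier of
    \<open>W\<close>, so that frontier lies in \<open>S\<close>, in the interior of
    \<open>\<Omega>\<close>; the frontier of \<open>\<Omega>\<close> is then made of level points
    alone.\<close>
  define S where "S = {z \<in> global_set - \<N>. rot F T z \<in> {..<real n + 1/2}}"
  define \<Omega> where "\<Omega> = W \<union> S"
  have open_diff: "open (global_set - \<N>)"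
    using open_global_set compact_imp_closed[OF compact_vanishing_set] by (simp add: \<N>_def open_Diff)
  have "open S"
    using continuous_open_preimage[OF rotc open_diff open_lessThan] by (simp add: S_def vimage_def Int_def)
  then have op: "open \<Omega>" unfolding \<Omega>_def by (rule open_Un[OF W(1)])
  have "0 \<in> \<N>"
    using T zero_mem_existence_interval phi_0 by (force simp: \<N>_def vanishing_set_def)
  then have zero: "0 \<in> \<Omega>" using W(2) by (auto simp: \<Omega>_def)
  have "bounded S"
  proof -
    have "\<forall>\<^sub>F z in inf at_infinity (principal (- \<N>)). ereal (real n + 1/2) < generalized_rot F T z"
      using order_tendstoD(1)[OF large] by (simp add: \<N>_def)
    then obtain B where B: "\<And>z. norm z \<ge> B \<Longrightarrow> z \<notin> \<N> \<Longrightarrow> ereal (real n + 1/2) < generalized_rot F T z"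
      unfolding eventually_inf_principal eventually_at_infinity by auto
    have "norm z \<le> B" if z: "z \<in> S" for z
    proof (rule ccontr)
      assume "\<not> norm z \<le> B"
      then have "ereal (real n + 1/2) < generalized_rot F T z" using B[of z] z by (auto simp: S_def)
      \<comment> \<open>On \<open>S\<close> the generalized rotation is the ordinary one, which is
        below the level.\<close>
      moreover have "{0..T} \<subseteq> existence_interval F 0 z"
        using z existence_interval_downward by (auto simp: S_def global_set_def)
      ultimately show False using z by (simp add: generalized_rot_def S_def)
    qed
    then show ?thesis unfolding bounded_iff by blast
  qed
  then have bdd: "bounded \<Omega>" using Wb by (simp add: \<Omega>_def)
  have fr: "z \<in> global_set - \<N> \<and> rot F T z = real n + 1/2" if z: "z \<in> frontier \<Omega>" for z
  proof -
    have zn: "z \<notin> W" "z \<notin> S" and "z \<in> closure W \<union> closure S"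
      using z op by (auto simp: frontier_def interior_open \<Omega>_def)
    moreover have "z \<notin> closure W"
    proof
      assume "z \<in> closure W"
      then have "z \<in> frontier W" using zn(1) W(1) by (simp add: frontier_def interior_open)
      then have "z \<in> S" using frW b[of z] n by (auto simp: S_def)
      then show False using zn by blast
    qed
    ultimately have "z \<in> closure S" by blast
    then obtain y where y: "\<And>k::nat. y k \<in> S" "y \<longlonglongrightarrow> z"
      unfolding closure_sequential by blast
    have ynv: "nonvanishing T (y k)" for k using y(1)[of k] nonv by (auto simp: S_def)
    \<comment> \<open>A limit outside \<open>global_set\<close> would start a solution that blows
      up, and \<open>rot F T (y k)\<close> would eventually exceed the level.\<close>
    have zg: "z \<in> global_set"
    proof (rule ccontr)
      assume "z \<notin> global_set"
      from rot_at_boundary[OF blow l ynv y(2) this]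
      have "\<forall>\<^sub>F k in sequentially. rot F T (y k) > real n + 1/2" .
      then obtain k where "rot F T (y k) > real n + 1/2" by (auto simp: eventually_sequentially)
      then show False using y(1)[of k] by (simp add: S_def)
    qed
    then have z1: "z \<in> global_set - \<N>" using zn(1) W(2) by blast
    then have "(\<lambda>k. rot F T (y k)) \<longlonglongrightarrow> rot F T z" using rot_continuous(2) nonv y(2) by blast
    then have "rot F T z \<le> real n + 1/2"
      using y(1) by (intro LIMSEQ_le_const2) (auto simp: S_def intro: less_imp_le)
    then show ?thesis using z1 zn(2) by (auto simp: S_def)
  qed
  have cl: "closure \<Omega> \<subseteq> global_set"
  proof
    fix z assume "z \<in> closure \<Omega>"
    then have "z \<in> \<Omega> \<or> z \<in> frontier \<Omega>" using op by (auto simp: frontier_def interior_open)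
    then show "z \<in> global_set" using fr[of z] Wcl closure_subset[of W] unfolding \<Omega>_def S_def by blast
  qed
  obtain z where "z \<in> closure \<Omega>" "\<phi> F T z = z"
  proof (rule leray_schauder[OF op bdd zero continuous_on_subset[OF phi_T_continuous cl]])
    fix z and \<mu> :: real assume z: "z \<in> frontier \<Omega>" and \<mu>: "\<mu> > 1"
    show "\<phi> F T z \<noteq> \<mu> *\<^sub>R z"
    proof
      assume eq: "\<phi> F T z = \<mu> *\<^sub>R z"
      obtain \<kappa> where \<kappa>: "\<kappa> > 0" "\<phi> F T z = - \<kappa> *\<^sub>R z"
        using half_turn[of T z n] fr[OF z] nonv by blast
      then have "(\<mu> + \<kappa>) *\<^sub>R z = 0" using eq by (simp add: scaleR_add_left)
      then have "z = 0" using \<mu> \<kappa>(1) by simp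
      then show False using fr[OF z] \<open>0 \<in> \<N>\<close> by blast
    qed
  qed
  then show thesis using that cl by blast
qed

end

theorem theorem3p1:
  fixes T :: real and F :: "real \<Rightarrow> real^2 \<Rightarrow> real^2"
  assumes "T > 0"
    and "caratheodory F" and "\<And>t z. F (t + T) z = F t z"
    and "unique_solutions F"
    and "\<And>t0. t0 \<in> {0..T} \<Longrightarrow> {0..T} \<subseteq> existence_interval F t0 0"
    and "\<And>z0 TF. blows_up_at F z0 TF \<Longrightarrow> TF \<le> T \<Longrightarrow>
           filterlim (\<lambda>t. rot F t z0) at_top (at_left TF)"
    and "(generalized_rot F T \<longlongrightarrow> \<infinity>) (inf at_infinity (principal (- vanishing_set F T)))"
    and "angular_liminf F T > -\<infinity>"
  shows "\<exists>x. solution_on F UNIV x \<and> (\<forall>t. x (t + T) = x t)"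
proof -
  interpret global_zero_system F T
    using assms(1,2,4,5) by unfold_locales auto
  \<comment> \<open>A supremum above \<open>-\<infinity>\<close> is taken over a nonempty set; any
    member serves as \<open>l\<close>, however negative.\<close>
  have "\<exists>l R. R > 0 \<and> (AE t in lebesgue_on {0..T}. \<forall>z. norm z \<ge> R \<longrightarrow> F t z \<bullet> (J *v z) \<ge> l * (norm z)\<^sup>2)"
    using assms(8) unfolding angular_liminf_def less_Sup_iff by blast
  then obtain l R where l: "R > 0"
    "AE t in lebesgue_on {0..T}. \<forall>z. norm z \<ge> R \<longrightarrow> F t z \<bullet> (J *v z) \<ge> l * (norm z)\<^sup>2" by blast
  obtain z where z: "z \<in> global_set" "\<phi> F T z = z"
    using fixed_point[OF assms(6) l assms(7)] by blast
  have "integral_solution F 0 T (\<lambda>t. \<phi> F t z)"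
    using phi_solution[of T z] z(1) assms(1) by (simp add: global_set_def)
  moreover have "\<phi> F T z = \<phi> F 0 z" using z(2) phi_0 by simp
  ultimately show ?thesis
    using periodic_extension[OF assms(2,1,3)] by blast
qed

end
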